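(* Let $F$ be a field of characteristic $2$, and let $p$ and $q$ be anisotropic quasilinear quadratic forms of dimension $\geq 2$ over $F$. Let $2^u$ be the largest power of $2$ dividing $\dim_{\mathrm{Izh}} p$. Then: (1) $\mathfrak{i}_1(p)\leq 2^u$; (2) If $q_{F(p)}$ is isotropic, then: (i) $\dim q>\dim_{\mathrm{Izh}} p$; (ii) $\mathfrak{i}_0(q_{F(p)})\leq\max\{\dim q-\dim_{\mathrm{Izh}} p-2^u,\;2^u\}$.
   Context: A quasilinear quadratic form over a field $F$ of characteristic $2$ is a map $\varphi\colon V_\varphi\to F$ on a finite-dimensional $F$-vector space with $\varphi(av+w)=a^2\varphi(v)+\varphi(w)$ for all $a\in F$, $v,w\in V_\varphi$; $\dim\varphi:=\dim V_\varphi$. The zero set $\{v:\varphi(v)=0\}$ is a subspace; its dimension is the isotropy index $\mathfrak{i}_0(\varphi)$, and $\varphi$ is anisotropic if $\mathfrak{i}_0(\varphi)=0$, isotropic otherwise. $\varphi_L$ denotes scalar extension to a field $L\supseteq F$. If $\varphi$ is anisotropic of dimension $\geq 2$, $F(\varphi)$ is the function field of the integral affine quadric $\{\varphi=0\}\subset\mathbb{A}(V_\varphi)$; $\mathfrak{i}_1(\varphi):=\mathfrak{i}_0(\varphi_{F(\varphi)})$; and $\dim_{\mathrm{Izh}}\varphi:=\dim\varphi-\mathfrak{i}_1(\varphi)$ (Izhboldin dimension). *)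

theory Defs
  imports "Jordan_Normal_Form.VS_Connect" "HOL-Algebra.QuotRing" "HOL-Library.Poly_Mapping"
begin

text \<open>The base field is a type \<open>'F :: field\<close>, viewed as a ring record through
  \<^const>\<open>class_ring\<close>. Extension fields are ring records, because the carrier of the function
  field of a form depends on the form.\<close>

section \<open>Quasilinear quadratic forms\<close>

definition quasilinear_form ::
    "('k, 'm) ring_scheme \<Rightarrow> ('k, 'v, 'n) module_scheme \<Rightarrow> ('v \<Rightarrow> 'k) \<Rightarrow> bool" where
  "quasilinear_form K V \<phi> \<longleftrightarrow>
     vectorspace K V \<and> vectorspace.fin_dim K V \<and> \<phi> \<in> carrier V \<rightarrow> carrier K \<and>
     (\<forall>a\<in>carrier K. \<forall>v\<in>carrier V. \<forall>w\<in>carrier V.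
        \<phi> (a \<odot>\<^bsub>V\<^esub> v \<oplus>\<^bsub>V\<^esub> w) = (a [^]\<^bsub>K\<^esub> (2::nat)) \<otimes>\<^bsub>K\<^esub> \<phi> v \<oplus>\<^bsub>K\<^esub> \<phi> w)"

definition isotropy_index ::
    "('k, 'm) ring_scheme \<Rightarrow> ('k, 'v, 'n) module_scheme \<Rightarrow> ('v \<Rightarrow> 'k) \<Rightarrow> nat" where
  "isotropy_index K V \<phi> =
     vectorspace.dim K (V\<lparr>carrier := {v \<in> carrier V. \<phi> v = \<zero>\<^bsub>K\<^esub>}\<rparr>)"

definition anisotropic ::
    "('k, 'm) ring_scheme \<Rightarrow> ('k, 'v, 'n) module_scheme \<Rightarrow> ('v \<Rightarrow> 'k) \<Rightarrow> bool" where
  "anisotropic K V \<phi> \<longleftrightarrow> isotropy_index K V \<phi> = 0"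

abbreviation isotropic ::
    "('k, 'm) ring_scheme \<Rightarrow> ('k, 'v, 'n) module_scheme \<Rightarrow> ('v \<Rightarrow> 'k) \<Rightarrow> bool" where
  "isotropic K V \<phi> \<equiv> \<not> anisotropic K V \<phi>"

section \<open>Scalar extension\<close>

text \<open>Scalar extension and the coordinate ring of the quadric are written in coordinates with
  respect to one fixed, arbitrarily chosen ordered basis of the space; another choice gives
  isomorphic objects.\<close>

definition chosen_basis :: "('k, 'm) ring_scheme \<Rightarrow> ('k, 'v, 'n) module_scheme \<Rightarrow> 'v list" where
  "chosen_basis K V = (SOME bs. distinct bs \<and> vectorspace.basis K V (set bs))"

text \<open>For a field embedding \<open>\<iota> : K \<rightarrow> L\<close> and the chosen basis \<open>b\<^sub>0, \<dots>, b\<^sub>n\<^sub>-\<^sub>1\<close> of \<open>V\<close>, a family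
  \<open>(x\<^sub>i)\<close> in the space below stands for \<open>\<Sum> x\<^sub>i \<otimes> b\<^sub>i\<close> in \<open>L \<otimes>\<^sub>K V\<close>.\<close>

definition ext_space ::
    "('k, 'm) ring_scheme \<Rightarrow> ('k, 'v, 'n) module_scheme \<Rightarrow> ('l, 'o) ring_scheme \<Rightarrow>
     ('l, nat \<Rightarrow> 'l) module" where
  "ext_space K V L = ring.func_space L {..<length (chosen_basis K V)}"

definition ext_form ::
    "('k, 'm) ring_scheme \<Rightarrow> ('k, 'v, 'n) module_scheme \<Rightarrow> ('v \<Rightarrow> 'k) \<Rightarrow>
     ('l, 'o) ring_scheme \<Rightarrow> ('k \<Rightarrow> 'l) \<Rightarrow> (nat \<Rightarrow> 'l) \<Rightarrow> 'l" where
  "ext_form K V \<phi> L \<iota> x =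
     (\<Oplus>\<^bsub>L\<^esub>i\<in>{..<length (chosen_basis K V)}.
        (x i [^]\<^bsub>L\<^esub> (2::nat)) \<otimes>\<^bsub>L\<^esub> \<iota> (\<phi> (chosen_basis K V ! i)))"

section \<open>The field of fractions of an integral domain\<close>

definition frac_rel :: "('r, 'm) ring_scheme \<Rightarrow> (('r \<times> 'r) \<times> ('r \<times> 'r)) set" where
  "frac_rel R = {((a, b), (c, d)). a \<in> carrier R \<and> b \<in> carrier R - {\<zero>\<^bsub>R\<^esub>} \<and>
     c \<in> carrier R \<and> d \<in> carrier R - {\<zero>\<^bsub>R\<^esub>} \<and> a \<otimes>\<^bsub>R\<^esub> d = c \<otimes>\<^bsub>R\<^esub> b}"

definition fraction :: "('r, 'm) ring_scheme \<Rightarrow> 'r \<Rightarrow> 'r \<Rightarrow> ('r \<times> 'r) set" where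
  "fraction R a b = frac_rel R `` {(a, b)}"

definition frac_field :: "('r, 'm) ring_scheme \<Rightarrow> ('r \<times> 'r) set ring" where
  "frac_field R =
     \<lparr>carrier = (carrier R \<times> (carrier R - {\<zero>\<^bsub>R\<^esub>})) // frac_rel R,
      mult = (\<lambda>X Y. \<Union>(a, b)\<in>X. \<Union>(c, d)\<in>Y. fraction R (a \<otimes>\<^bsub>R\<^esub> c) (b \<otimes>\<^bsub>R\<^esub> d)),
      one = fraction R \<one>\<^bsub>R\<^esub> \<one>\<^bsub>R\<^esub>,
      zero = fraction R \<zero>\<^bsub>R\<^esub> \<one>\<^bsub>R\<^esub>,
      add = (\<lambda>X Y. \<Union>(a, b)\<in>X. \<Union>(c, d)\<in>Y.
               fraction R (a \<otimes>\<^bsub>R\<^esub> d \<oplus>\<^bsub>R\<^esub> c \<otimes>\<^bsub>R\<^esub> b) (b \<otimes>\<^bsub>R\<^esub> d))\<rparr>"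

section \<open>The affine quadric of a form and its function field\<close>

text \<open>\<open>(nat \<Rightarrow>\<^sub>0 nat) \<Rightarrow>\<^sub>0 'F\<close> is the polynomial ring over \<open>'F\<close> in variables \<open>X\<^sub>0, X\<^sub>1, \<dots>\<close>:
  a monomial is its exponent function, and \<open>Poly_Mapping.single m c\<close> is the term
  with monomial \<open>m\<close> and coefficient \<open>c\<close>.\<close>

definition poly_ring :: "nat \<Rightarrow> ((nat \<Rightarrow>\<^sub>0 nat) \<Rightarrow>\<^sub>0 'F::field) ring" where
  "poly_ring n =
     class_ring\<lparr>carrier := {f. \<forall>m\<in>Poly_Mapping.keys f. Poly_Mapping.keys m \<subseteq> {..<n}}\<rparr>"

definition form_poly :: "('F::field, 'v, 'n) module_scheme \<Rightarrow> ('v \<Rightarrow> 'F) \<Rightarrow> (nat \<Rightarrow>\<^sub>0 nat) \<Rightarrow>\<^sub>0 'F"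
  where
  "form_poly V \<phi> =
     (\<Sum>i<length (chosen_basis class_ring V).
        Poly_Mapping.single (Poly_Mapping.single i 2) (\<phi> (chosen_basis class_ring V ! i)))"

definition quadric_ideal ::
    "('F::field, 'v, 'n) module_scheme \<Rightarrow> ('v \<Rightarrow> 'F) \<Rightarrow> ((nat \<Rightarrow>\<^sub>0 nat) \<Rightarrow>\<^sub>0 'F) set" where
  "quadric_ideal V \<phi> =
     PIdl\<^bsub>poly_ring (length (chosen_basis class_ring V))\<^esub> (form_poly V \<phi>)"

definition quadric_ring ::
    "('F::field, 'v, 'n) module_scheme \<Rightarrow> ('v \<Rightarrow> 'F) \<Rightarrow> ((nat \<Rightarrow>\<^sub>0 nat) \<Rightarrow>\<^sub>0 'F) set ring" where
  "quadric_ring V \<phi> =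
     poly_ring (length (chosen_basis class_ring V)) Quot quadric_ideal V \<phi>"

text \<open>Meaningful when \<open>\<phi>\<close> is anisotropic of dimension at least 2, so that the coordinate
  ring of the quadric is an integral domain.\<close>

definition function_field ::
    "('F::field, 'v, 'n) module_scheme \<Rightarrow> ('v \<Rightarrow> 'F) \<Rightarrow>
     (((nat \<Rightarrow>\<^sub>0 nat) \<Rightarrow>\<^sub>0 'F) set \<times> ((nat \<Rightarrow>\<^sub>0 nat) \<Rightarrow>\<^sub>0 'F) set) set ring" where
  "function_field V \<phi> = frac_field (quadric_ring V \<phi>)"

definition function_field_embed ::
    "('F::field, 'v, 'n) module_scheme \<Rightarrow> ('v \<Rightarrow> 'F) \<Rightarrow> 'F \<Rightarrow>
     (((nat \<Rightarrow>\<^sub>0 nat) \<Rightarrow>\<^sub>0 'F) set \<times> ((nat \<Rightarrow>\<^sub>0 nat) \<Rightarrow>\<^sub>0 'F) set) set" where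
  "function_field_embed V \<phi> c =
     fraction (quadric_ring V \<phi>)
       (quadric_ideal V \<phi> +>\<^bsub>poly_ring (length (chosen_basis class_ring V))\<^esub>
          Poly_Mapping.single 0 c)
       \<one>\<^bsub>quadric_ring V \<phi>\<^esub>"

section \<open>Invariants\<close>

text \<open>\<open>isotropy_index_over W q V p\<close> is the isotropy index of the scalar extension of
  \<open>q\<close> to the function field of \<open>p\<close>, where \<open>q\<close> lives on \<open>W\<close> and \<open>p\<close> on \<open>V\<close>.\<close>

definition isotropy_index_over ::
    "('F::field, 'w, 'o) module_scheme \<Rightarrow> ('w \<Rightarrow> 'F) \<Rightarrow>
     ('F, 'v, 'n) module_scheme \<Rightarrow> ('v \<Rightarrow> 'F) \<Rightarrow> nat" where
  "isotropy_index_over W q V p =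
     isotropy_index (function_field V p) (ext_space class_ring W (function_field V p))
       (ext_form class_ring W q (function_field V p) (function_field_embed V p))"

definition isotropic_over ::
    "('F::field, 'w, 'o) module_scheme \<Rightarrow> ('w \<Rightarrow> 'F) \<Rightarrow>
     ('F, 'v, 'n) module_scheme \<Rightarrow> ('v \<Rightarrow> 'F) \<Rightarrow> bool" where
  "isotropic_over W q V p \<longleftrightarrow>
     isotropic (function_field V p) (ext_space class_ring W (function_field V p))
       (ext_form class_ring W q (function_field V p) (function_field_embed V p))"

definition i1 :: "('F::field, 'v, 'n) module_scheme \<Rightarrow> ('v \<Rightarrow> 'F) \<Rightarrow> nat" where
  "i1 V p = isotropy_index_over V p V p"

text \<open>The natural number subtraction does not truncate: the isotropy index of an extension of
  \<open>p\<close> is at most the dimension of \<open>p\<close>.\<close>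

definition dim_Izh :: "('F::field, 'v, 'n) module_scheme \<Rightarrow> ('v \<Rightarrow> 'F) \<Rightarrow> nat" where
  "dim_Izh V p = vectorspace.dim class_ring V - i1 V p"

end

theory Submission
  imports Defs "HOL-Algebra.Embedded_Algebras" "HOL-Computational_Algebra.Fraction_Field"
begin

text \<open>Write \<open>a\<^sub>0, \<dots>, a\<^sub>n\<^sub>-\<^sub>1\<close> and \<open>q\<^sub>0, \<dots>, q\<^sub>m\<^sub>-\<^sub>1\<close> for the diagonal coefficients of \<open>p\<close> and \<open>q\<close>;
  anisotropy means that each of the two families is linearly independent over \<open>F\<^sup>2\<close>. Squaring identifies \<open>L = F(p)\<close> with
  \<open>L\<^sup>2 = K(b) = K + Kb\<close>, where \<open>K = F\<^sup>2(Y\<^sub>1, \<dots>, Y\<^sub>n\<^sub>-\<^sub>1)\<close>, \<open>Y\<^sub>i = X\<^sub>i\<^sup>2\<close> and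
  \<open>b = X\<^sub>0\<^sup>2 = \<Sum> (a\<^sub>k / a\<^sub>0) Y\<^sub>k\<close>. Inside \<open>F(Y)\<close> let \<open>S\<close> and \<open>T = S + bS\<close> be the spans of the \<open>q\<^sub>i\<close> over \<open>K\<close> and
  \<open>L\<^sup>2\<close>. Then \<open>i\<^sub>0(q\<^sub>L) = m - dim T\<close>, and counting dimensions over \<open>K\<close> shows that \<open>A = S \<inter> bS\<close> has
  dimension \<open>i\<^sub>0(q\<^sub>L)\<close> over \<open>L\<^sup>2\<close>.

  If \<open>s \<in> A\<close>, differentiating the relation \<open>bs \<in> S\<close> with respect to \<open>Y\<^sub>k\<close>, which maps \<open>K\<close> to
  itself and therefore \<open>S\<close> to itself, gives \<open>(a\<^sub>k / a\<^sub>0) s \<in> T\<close>. Hence \<open>A B \<subseteq> T\<close>, where \<open>B\<close> is the \<open>L\<^sup>2\<close>-span of the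
  \<open>a\<^sub>k / a\<^sub>0\<close>, which has dimension \<open>d = dim\<^sub>I\<^sub>z\<^sub>h p\<close>. So \<open>d \<le> dim T\<close> as soon as \<open>A \<noteq> 0\<close>. A linear version of
  Dyson's \<open>e\<close>-transform ends in a subspace of \<open>T\<close> that is stable under a field of \<open>2\<close>-power degree over \<open>L\<^sup>2\<close>, and
  this forces \<open>dim T \<ge> d + 2\<^sup>u\<close> whenever \<open>dim A > 2\<^sup>u\<close>. The case \<open>q = p\<close>, where \<open>dim T = d\<close>, bounds \<open>i\<^sub>1(p)\<close>.\<close>

section \<open>Subspaces of a field over a subfield\<close>

text \<open>The interpretation of \<^const>\<open>class_ring\<close> predates the theory of embedded algebras, whose
  facts are therefore not available for it; the synonym \<^const>\<open>class_field\<close> provides them.\<close>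

interpretation tc: field "class_field :: 'a::field ring"
  rewrites tc_carrier: "carrier class_field = UNIV"
    and tc_mult: "mult class_field = (*)"
    and tc_add: "add class_field = (+)"
    and tc_one: "one class_field = 1"
    and tc_zero: "zero class_field = 0"
    and tc_a_inv: "a_inv class_field = uminus"
    and tc_a_minus: "a_minus class_field = minus"
    and tc_finsum: "finsum class_field = sum"
    and tc_pow: "pow (class_field :: 'a ring) = (^)"
    and tc_m_inv: "m_inv (class_field :: 'a ring) x = (if x = 0 then div0 else inverse x)"
  unfolding class_field_def using class_field by (simp_all add: class_ring_simps)

abbreviation subfield_in :: "'a::field set \<Rightarrow> bool" where
  "subfield_in K \<equiv> subfield K class_field"

text \<open>Closure under negation is left to follow from \<open>-1 \<in> K\<close> for a subfield
  \<open>K\<close>. As \<open>K\<close> enters only as a set of scalars, restriction to a smaller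
  field is immediate.\<close>

definition subspace_over :: "'a::field set \<Rightarrow> 'a set \<Rightarrow> bool" where
  "subspace_over K V \<longleftrightarrow> 0 \<in> V \<and> (\<forall>v\<in>V. \<forall>w\<in>V. v + w \<in> V) \<and> (\<forall>k\<in>K. \<forall>v\<in>V. k * v \<in> V)"

lemma subfield_inI:
  fixes K :: "'a::field set"
  assumes "1 \<in> K" "\<And>x y. x \<in> K \<Longrightarrow> y \<in> K \<Longrightarrow> x - y \<in> K" "\<And>x y. x \<in> K \<Longrightarrow> y \<in> K \<Longrightarrow> x * y \<in> K"
    "\<And>x. x \<in> K \<Longrightarrow> x \<noteq> 0 \<Longrightarrow> inverse x \<in> K"
  shows "subfield_in K"
proof (rule tc.subfieldI')
  show "subring K class_field"
  proof (rule tc.subringI)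
    have z: "0 \<in> K" using assms(2)[OF assms(1) assms(1)] by simp
    show m: "\<And>h. h \<in> K \<Longrightarrow> - h \<in> K" using assms(2)[OF z] by simp
    show "\<And>h1 h2. h1 \<in> K \<Longrightarrow> h2 \<in> K \<Longrightarrow> h1 + h2 \<in> K"
      using assms(2) m by (metis diff_minus_eq_add)
  qed (use assms in auto)
  show "\<And>k. k \<in> K - {0} \<Longrightarrow> (if k = 0 then div0 else inverse k) \<in> K"
    using assms by simp
qed

lemma subfield_inD:
  fixes K :: "'a::field set"
  assumes "subfield_in K"
  shows "1 \<in> K" "0 \<in> K" "\<And>x y. x \<in> K \<Longrightarrow> y \<in> K \<Longrightarrow> x + y \<in> K" "\<And>x. x \<in> K \<Longrightarrow> - x \<in> K"
    "\<And>x y. x \<in> K \<Longrightarrow> y \<in> K \<Longrightarrow> x - y \<in> K"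
    "\<And>x y. x \<in> K \<Longrightarrow> y \<in> K \<Longrightarrow> x * y \<in> K" "\<And>x. x \<in> K \<Longrightarrow> inverse x \<in> K"
proof -
  have sr: "subring K class_field" using assms by (simp add: subfieldE)
  show "1 \<in> K" "0 \<in> K" using subringE(2,3)[OF sr] by (simp_all add: tc_one tc_zero)
  then show "\<And>x. x \<in> K \<Longrightarrow> inverse x \<in> K"
    using tc.subfield_m_inv(1)[OF assms] by (metis DiffE DiffI inverse_zero singletonD)
  show a: "\<And>x y. x \<in> K \<Longrightarrow> y \<in> K \<Longrightarrow> x + y \<in> K" "\<And>x y. x \<in> K \<Longrightarrow> y \<in> K \<Longrightarrow> x * y \<in> K"
    using subringE(6,7)[OF sr] by (simp_all add: tc_add tc_mult)
  show m: "\<And>x. x \<in> K \<Longrightarrow> - x \<in> K" using subringE(5)[OF sr] by (simp add: tc_a_inv)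
  show "\<And>x y. x \<in> K \<Longrightarrow> y \<in> K \<Longrightarrow> x - y \<in> K" using a(1) m by (metis add_uminus_conv_diff)
qed

lemma subspace_overD:
  assumes "subspace_over K V"
  shows "0 \<in> V" "\<And>v w. v \<in> V \<Longrightarrow> w \<in> V \<Longrightarrow> v + w \<in> V" "\<And>k v. k \<in> K \<Longrightarrow> v \<in> V \<Longrightarrow> k * v \<in> V"
  using assms by (auto simp: subspace_over_def)

lemma subspace_over_uminus: "subspace_over K V \<Longrightarrow> subfield_in K \<Longrightarrow> v \<in> V \<Longrightarrow> - v \<in> V"
  using subspace_overD(3)[of K V "-1" v] subfield_inD(1,4) by fastforce

lemma subspace_over_diff: "subspace_over K V \<Longrightarrow> subfield_in K \<Longrightarrow> v \<in> V \<Longrightarrow> w \<in> V \<Longrightarrow> v - w \<in> V"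
  using subspace_over_uminus subspace_overD(2)[of K V v "-w"] by fastforce

lemma subspace_over_sum: "subspace_over K V \<Longrightarrow> (\<And>i. i \<in> I \<Longrightarrow> f i \<in> V) \<Longrightarrow> sum f I \<in> V"
  by (induct I rule: infinite_finite_induct) (auto simp: subspace_over_def)

lemma dimension_subspace_over: "subfield_in K \<Longrightarrow> tc.dimension n K V \<Longrightarrow> subspace_over K V"
  unfolding subspace_over_def using tc.space_subgroup_props[of K n V] by blast

lemma Span_subspace_over: "subfield_in K \<Longrightarrow> subspace_over K (tc.Span K us)"
  using tc.Span_finite_dimension[of K us] dimension_subspace_over unfolding tc.finite_dimension_def over_def
  by blast

lemma Span_subset:
  assumes "subspace_over K V" "set us \<subseteq> V"
  shows "tc.Span K us \<subseteq> V"
  using assms(2)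
proof (induct us)
  case (Cons u us)
  then show ?case
    using subspace_overD[OF assms(1)] by (auto simp: tc.line_extension_mem_iff subset_iff)
qed (use assms in \<open>auto simp: subspace_over_def\<close>)

text \<open>Independent lists in \<open>W\<close> have length at most \<open>n\<close>; a longest
  one spans \<open>W\<close>, since any vector outside its span could be prepended.\<close>

lemma subspace_has_dimension:
  assumes K: "subfield_in K" and V: "tc.dimension n K V" and W: "subspace_over K W" "W \<subseteq> V"
  obtains m where "m \<le> n" "tc.dimension m K W"
proof -
  let ?P = "\<lambda>m. \<exists>us. tc.independent K us \<and> set us \<subseteq> W \<and> length us = m"
  have b: "?P m \<Longrightarrow> m \<le> n" for m
    using tc.independent_length_le_dimension[OF K V] W(2) by auto
  have "?P 0" using tc.li_Nil by auto
  then have "?P (Greatest ?P)" using b GreatestI_nat[of ?P 0 n] by blast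
  then obtain us where us: "tc.independent K us" "set us \<subseteq> W" "length us = Greatest ?P" by auto
  have "W \<subseteq> tc.Span K us"
  proof
    fix w assume w: "w \<in> W"
    show "w \<in> tc.Span K us"
    proof (rule ccontr)
      assume "w \<notin> tc.Span K us"
      then have "tc.independent K (w # us)" using us(1) by (intro tc.li_Cons) auto
      then have "?P (Suc (length us))" using us w by (intro exI[of _ "w # us"]) auto
      then have "Suc (length us) \<le> Greatest ?P" using Greatest_le_nat[of ?P _ n] b by blast
      then show False using us(3) by simp
    qed
  qed
  then have "tc.Span K us = W" using Span_subset[OF W(1) us(2)] by auto
  then have "tc.dimension (length us) K W" using tc.dimensionI[OF K us(1)] by auto
  then show thesis using that b us by blast
qed

lemma dimension_mono:
  assumes K: "subfield_in K" and "tc.dimension n K V" "tc.dimension m K W" "W \<subseteq> V"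
  shows "m \<le> n"
proof -
  obtain k where "k \<le> n" "tc.dimension k K W"
    using subspace_has_dimension[OF K assms(2) dimension_subspace_over[OF K assms(3)] assms(4)] .
  then show ?thesis using tc.dimension_is_inj[OF K assms(3)] by auto
qed

lemma dimension_mono_strict:
  assumes K: "subfield_in K" and V: "tc.dimension n K V" and W: "tc.dimension m K W" and "W \<subset> V"
  shows "m < n"
proof -
  obtain us where us: "tc.independent K us" "length us = m" "tc.Span K us = W"
    using tc.exists_base[OF K W] by auto
  then have "set us \<subseteq> V" using tc.Span_base_incl[OF K, of us] assms(4) by auto
  then have "length us \<noteq> n"
    using tc.independent_length_eq_dimension[OF K V us(1)] us(3) assms(4) by auto
  then show ?thesis using dimension_mono[OF K V W] assms(4) us by auto
qed

lemma dimension_scale: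
  assumes "tc.dimension n K V" "e \<noteq> (0::'a::field)"
  shows "tc.dimension n K ((*) e ` V)"
  using assms(1)
proof (induct rule: tc.dimension.induct)
  case (zero_dim K)
  then show ?case using tc.zero_dim by auto
next
  case (Suc_dim v E n K)
  have "(*) e ` tc.line_extension K v E = tc.line_extension K (e * v) ((*) e ` E)"
    (is "?l = ?r")
  proof (intro subset_antisym subsetI)
    fix x assume "x \<in> ?l"
    then obtain k u where "k \<in> K" "u \<in> E" "x = e * (k * v + u)"
      by (auto simp: tc.line_extension_mem_iff)
    then show "x \<in> ?r"
      unfolding tc.line_extension_mem_iff
      by (intro bexI[of _ k] bexI[of _ "e * u"]) (auto simp: algebra_simps)
  next
    fix x assume "x \<in> ?r"
    then obtain k u where "k \<in> K" "u \<in> E" "x = k * (e * v) + e * u"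
      by (auto simp: tc.line_extension_mem_iff)
    then show "x \<in> ?l"
      by (intro image_eqI[of _ _ "k * v + u"]) (auto simp: tc.line_extension_mem_iff algebra_simps)
  qed
  moreover have "e * v \<notin> (*) e ` E" using Suc_dim assms(2) by auto
  ultimately show ?case using Suc_dim tc.Suc_dim[of "e * v"] by auto
qed

lemma subspace_over_scale: "subspace_over K V \<Longrightarrow> subspace_over K ((*) e ` V)"
  unfolding subspace_over_def image_iff
  by (auto simp: distrib_left[symmetric] mult.left_commute[of _ e])

lemma dimension_set_add:
  assumes K: "subfield_in K" and "tc.dimension n K E" "tc.dimension m K F" "tc.dimension k K (E \<inter> F)"
  shows "tc.dimension (n + m - k) K {x + y | x y. x \<in> E \<and> y \<in> F}"
proof -
  have "E <+>\<^bsub>class_field\<^esub> F = {x + y | x y. x \<in> E \<and> y \<in> F}"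
    unfolding set_add_def' by (auto simp: tc_add)
  then show ?thesis using tc.dimension_sum_space[OF K assms(2-4)] by simp
qed

text \<open>A \<open>K\<close>-basis of \<open>V\<close> spans \<open>V\<close> over
  \<open>H\<close> as well, so \<open>V\<close> is finite-dimensional over \<open>H\<close>;
  multiplicativity of dimensions then gives \<open>w = h * c\<close>.\<close>

lemma tower_dimension:
  assumes K: "subfield_in K" and H: "subfield_in H" and "K \<subseteq> H" "tc.dimension h K H" "tc.dimension w K V"
    and V: "subspace_over H V"
  obtains c where "w = h * c" "tc.dimension c H V"
proof -
  obtain us where us: "tc.independent K us" "length us = w" "tc.Span K us = V"
    using tc.exists_base[OF K assms(5)] by auto
  have "set us \<subseteq> V" using tc.Span_base_incl[OF K, of us] us by auto
  then have "tc.Span H us \<subseteq> V" by (rule Span_subset[OF V])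
  moreover have "V \<subseteq> tc.Span H us"
  proof -
    have "subspace_over K (tc.Span H us)"
      using Span_subspace_over[OF H, of us] \<open>K \<subseteq> H\<close> by (auto simp: subspace_over_def)
    then show ?thesis using Span_subset[of K "tc.Span H us" us] tc.Span_base_incl[OF H, of us] us by auto
  qed
  ultimately have "tc.Span H us = V" by simp
  then obtain c where c: "tc.dimension c H V"
    using tc.Span_finite_dimension[OF H, of us] unfolding tc.finite_dimension_def over_def by auto
  then have "w = h * c"
    using tc.telescopic_base[OF K H assms(4) c] tc.dimension_is_inj[OF K assms(5)] by simp
  then show thesis using that c by blast
qed

section \<open>Products of subspaces in an extension of exponent one\<close>

lemma square_inverse:
  fixes x :: "'a::field"
  assumes "subfield_in N" "x\<^sup>2 \<in> N" "x \<noteq> 0"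
  shows "inverse x = inverse (x\<^sup>2) * x" "inverse (x\<^sup>2) \<in> N"
  using assms subfield_inD(7) by (auto simp: power2_eq_square field_simps)

lemma char2_square_add:
  fixes x y :: "'a::comm_ring_1"
  assumes "(2::'a) = 0"
  shows "(x + y)\<^sup>2 = x\<^sup>2 + y\<^sup>2" "(x - y)\<^sup>2 = x\<^sup>2 + y\<^sup>2" "- x = x" "x + x = 0"
proof -
  have z: "2 * x * y = 0" using assms by simp
  then show "(x + y)\<^sup>2 = x\<^sup>2 + y\<^sup>2" by (simp add: power2_sum)
  show "(x - y)\<^sup>2 = x\<^sup>2 + y\<^sup>2" using z by (simp add: power2_diff)
  show "x + x = 0" using assms by (metis mult_2 mult_zero_left)
  then show "- x = x" by (simp add: minus_unique)
qed

text \<open>Inverses come from squares: \<open>inverse x\<close> is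
  \<open>inverse (x\<^sup>2) * x\<close>, and the first factor lies in \<open>N\<close>.\<close>

lemma exponent_one_subfield:
  fixes H N :: "'a::field set"
  assumes "subfield_in N" "N \<subseteq> H" "\<And>x. x \<in> H \<Longrightarrow> x\<^sup>2 \<in> N"
    "\<And>x y. x \<in> H \<Longrightarrow> y \<in> H \<Longrightarrow> x - y \<in> H" "\<And>x y. x \<in> H \<Longrightarrow> y \<in> H \<Longrightarrow> x * y \<in> H"
  shows "subfield_in H"
proof (rule subfield_inI)
  show "1 \<in> H" using assms(1,2) subfield_inD(1) by auto
  show "inverse x \<in> H" if "x \<in> H" "x \<noteq> 0" for x
    using square_inverse[OF assms(1) assms(3)[OF that(1)] that(2)] assms(2,5) that(1)
    by (metis subsetD)
qed (use assms in auto)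

text \<open>In characteristic 2,
  \<open>(k + l * x)\<^sup>2 = k\<^sup>2 + l\<^sup>2 * x\<^sup>2\<close> lies in \<open>K\<close>,
  so \<open>exponent_one_subfield\<close> applies.\<close>

lemma quadratic_extension:
  fixes K :: "'a::field set"
  assumes two: "(2::'a) = 0" and K: "subfield_in K" and x: "x\<^sup>2 \<in> K" "x \<notin> K"
  shows "subfield_in {k + l * x | k l. k \<in> K \<and> l \<in> K}" (is "subfield_in ?L")
    and "tc.dimension 2 K {k + l * x | k l. k \<in> K \<and> l \<in> K}"
    and "K \<subseteq> {k + l * x | k l. k \<in> K \<and> l \<in> K}" "x \<in> {k + l * x | k l. k \<in> K \<and> l \<in> K}"
proof -
  note c = subfield_inD[OF K]
  show KL: "K \<subseteq> ?L"
    using c(2) by (force intro: exI[of _ 0])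
  show "x \<in> ?L" using c(1,2) by (force intro: exI[of _ 0] exI[of _ 1])
  have "?L = tc.line_extension K x K"
    by (intro subset_antisym subsetI) (auto simp: tc.line_extension_mem_iff add.commute Bex_def)
  then show "tc.dimension 2 K ?L"
    using tc.Suc_dim[of x K 1 K] tc.dimension_one[OF K] x(2) by (simp add: numeral_2_eq_2)
  show "subfield_in ?L"
  proof (rule exponent_one_subfield[OF K KL])
    fix y assume "y \<in> ?L"
    then obtain k l where kl: "k \<in> K" "l \<in> K" "y = k + l * x" by auto
    then show "y\<^sup>2 \<in> K"
      using c x(1) by (simp add: char2_square_add[OF two] power_mult_distrib) (simp add: power2_eq_square)
    fix z assume "z \<in> ?L"
    then obtain k' l' where kl': "k' \<in> K" "l' \<in> K" "z = k' + l' * x" by auto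
    have "y - z = (k - k') + (l - l') * x" by (simp add: kl kl' algebra_simps)
    then show "y - z \<in> ?L" using kl kl' c(5) by blast
    have "y * z = (k * k' + l * l' * x\<^sup>2) + (k * l' + l * k') * x"
      by (simp add: kl kl' algebra_simps power2_eq_square)
    moreover have "k * k' + l * l' * x\<^sup>2 \<in> K" "k * l' + l * k' \<in> K"
      using kl kl' x(1) by (auto intro!: c(3,6))
    ultimately show "y * z \<in> ?L" by blast
  qed
qed

text \<open>Among the intermediate fields of 2-power degree there is a largest one, because
  \<open>v < 2 ^ v \<le> h\<close>. Adjoining an element of \<open>H\<close> outside it would double
  the degree.\<close>

lemma exponent_one_degree:
  fixes N H :: "'a::field set"
  assumes two: "(2::'a) = 0" and N: "subfield_in N" and H: "subfield_in H" and "N \<subseteq> H"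
    and sq: "\<And>x. x \<in> H \<Longrightarrow> x\<^sup>2 \<in> N" and h: "tc.dimension h N H"
  obtains v where "h = 2 ^ v"
proof -
  let ?P = "\<lambda>v. \<exists>K. subfield_in K \<and> N \<subseteq> K \<and> K \<subseteq> H \<and> tc.dimension (2 ^ v) N K"
  have b: "v \<le> h" if "?P v" for v
  proof -
    have "2 ^ v \<le> h" using that dimension_mono[OF N h] by blast
    then show ?thesis using less_exp[of v] by linarith
  qed
  have "?P 0" using tc.dimension_one[OF N] N \<open>N \<subseteq> H\<close> by auto
  then have "?P (Greatest ?P)" using b GreatestI_nat[of ?P 0 h] by blast
  then obtain K where K: "subfield_in K" "N \<subseteq> K" "K \<subseteq> H" "tc.dimension (2 ^ Greatest ?P) N K" by auto
  have "H \<subseteq> K"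
  proof
    fix x assume x: "x \<in> H"
    show "x \<in> K"
    proof (rule ccontr)
      assume xK: "x \<notin> K"
      let ?L = "{k + l * x | k l. k \<in> K \<and> l \<in> K}"
      have x2: "x\<^sup>2 \<in> K" using sq x K(2) by auto
      note q = quadratic_extension[OF two K(1) x2 xK]
      have "?L \<subseteq> H" using K(3) x by (auto intro!: subfield_inD(3,6)[OF H])
      moreover have "tc.dimension (2 ^ Suc (Greatest ?P)) N ?L"
        using tc.telescopic_base[OF N K(1) K(4) q(2)] by (simp add: mult.commute)
      ultimately have "?P (Suc (Greatest ?P))" using q(1,3) K(2) by blast
      then have "Suc (Greatest ?P) \<le> Greatest ?P" using Greatest_le_nat[of ?P _ h] b by blast
      then show False by simp
    qed
  qed
  then have "h = 2 ^ Greatest ?P" using K(3,4) tc.dimension_is_inj[OF N h] by auto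
  then show thesis using that by blast
qed

text \<open>The linear form of Dyson's \<open>e\<close>-transform: \<open>A\<close> is replaced by \<open>A \<inter> e\<^sup>-\<^sup>1B\<close> and \<open>B\<close> by
  \<open>B + Ae\<close>.\<close>

lemma e_transform:
  assumes N: "subfield_in N" and "tc.dimension a N A" "tc.dimension b N B" "1 \<in> A"
    and T: "subspace_over N T" "\<And>x y. x \<in> A \<Longrightarrow> y \<in> B \<Longrightarrow> x * y \<in> T"
  obtains a' A' b' B' where "tc.dimension a' N A'" "tc.dimension b' N B'" "a' + b' = a + b"
    "1 \<in> A'" "A' \<subseteq> A" "B \<subseteq> B'" "B' \<subseteq> T" "\<forall>x\<in>A'. \<forall>y\<in>B'. x * y \<in> B'"
  using assms(2-)
proof (induct a arbitrary: A B b thesis rule: less_induct)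
  case (less a)
  note A = dimension_subspace_over[OF N less.prems(2)] and B = dimension_subspace_over[OF N less.prems(3)]
  show ?case
  proof (cases "\<forall>x\<in>A. \<forall>y\<in>B. x * y \<in> B")
    case True
    have "B \<subseteq> T" using less.prems(6)[OF \<open>1 \<in> A\<close>] by auto
    then show thesis using less.prems(1)[of a A b B] less.prems True by auto
  next
    case False
    then obtain x e where xe: "x \<in> A" "e \<in> B" "x * e \<notin> B" by auto
    have e: "e \<noteq> 0" using xe(3) subspace_overD(1)[OF B] by auto
    let ?A = "{x \<in> A. x * e \<in> B}" and ?B = "{y + z | y z. y \<in> B \<and> z \<in> (*) e ` A}"
    have sA: "subspace_over N ?A"
      using subspace_overD[OF A] subspace_overD[OF B] by (auto simp: subspace_over_def distrib_right mult.assoc)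
    have "?A \<subset> A" using xe by auto
    obtain a' where a': "tc.dimension a' N ?A"
      using subspace_has_dimension[OF N less.prems(2) sA] by blast
    \<comment> \<open>The element \<open>x\<close> has left \<open>A\<close>, so the induction on
      the dimension of \<open>A\<close> applies.\<close>
    have lt: "a' < a" by (rule dimension_mono_strict[OF N less.prems(2) a' \<open>?A \<subset> A\<close>])
    \<comment> \<open>Multiplied by \<open>e\<close>, the shrunken \<open>A\<close> becomes the
      intersection of \<open>B\<close> with \<open>e A\<close>. Hence \<open>B\<close> gains exactly
      the dimension that \<open>A\<close> loses.\<close>
    have "(*) e ` ?A = B \<inter> (*) e ` A" by (auto simp: mult.commute)
    then have "tc.dimension a' N (B \<inter> (*) e ` A)" using dimension_scale[OF a' e] by simp
    from dimension_set_add[OF N less.prems(3) dimension_scale[OF less.prems(2) e] this]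
    have B': "tc.dimension (b + a - a') N ?B" .
    have 1: "1 \<in> ?A" using less.prems(4) xe(2) by simp
    \<comment> \<open>Writing \<open>y = y1 + e * z\<close>, the product is
      \<open>x * y1 + z * (x * e)\<close>, and \<open>x * e \<in> B\<close> by the choice of
      \<open>?A\<close>.\<close>
    have prod: "x * y \<in> T" if xy: "x \<in> ?A" "y \<in> ?B" for x y
    proof -
      obtain y1 z where "y = y1 + e * z" "y1 \<in> B" "z \<in> A" using xy(2) by auto
      moreover from this have "x * y1 \<in> T" "z * (x * e) \<in> T"
        using less.prems(6) xy(1) by blast+
      moreover have "x * (y1 + e * z) = x * y1 + z * (x * e)" by (simp add: algebra_simps)
      ultimately show ?thesis using subspace_overD(2)[OF less.prems(5)] by simp
    qed
    have sub: "B \<subseteq> ?B"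
    proof
      fix y assume "y \<in> B"
      moreover have "0 \<in> (*) e ` A" using subspace_overD(1)[OF A] by auto
      ultimately show "y \<in> ?B" by (intro CollectI exI[of _ y] exI[of _ 0]) simp
    qed
    show thesis
    proof (rule less.hyps[OF lt _ a' B' 1 less.prems(5) prod])
      fix A'' B'' a'' b''
      assume "tc.dimension a'' N A''" "tc.dimension b'' N B''" "a'' + b'' = a' + (b + a - a')"
        "1 \<in> A''" "A'' \<subseteq> ?A" "?B \<subseteq> B''" "B'' \<subseteq> T" "\<forall>x\<in>A''. \<forall>y\<in>B''. x * y \<in> B''"
      moreover from this have "A'' \<subseteq> A" "B \<subseteq> B''" "a'' + b'' = a + b" using sub lt by auto
      ultimately show thesis using less.prems(1)[of a'' A'' b'' B''] by blast
    qed
  qed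
qed

text \<open>The subspace \<open>B'\<close> reached by the transform is a vector space over its stabiliser \<open>H\<close>, which has
  degree \<open>2\<^sup>v \<ge> dim A'\<close>. If \<open>v\<close> exceeds the \<open>2\<close>-adic valuation of \<open>dim B\<close>, then \<open>dim B'\<close> and \<open>dim B\<close> differ by
  divisibility alone; otherwise \<open>dim A' + dim B' = dim A + dim B\<close> gives the bound. In contrast to Kneser's
  theorem, a single pair \<open>(A', B')\<close> suffices.\<close>

lemma dimension_product_bound_aux:
  fixes N A B T :: "'a::field set"
  assumes two: "(2::'a) = 0" and N: "subfield_in N" and A: "tc.dimension a N A" "1 \<in> A"
    and B: "tc.dimension b N B" "b > 0" and T: "tc.dimension t N T"
    and sq: "\<And>x. x \<in> A \<Longrightarrow> x\<^sup>2 \<in> N" and prod: "\<And>x y. x \<in> A \<Longrightarrow> y \<in> B \<Longrightarrow> x * y \<in> T"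
    and a: "a > 2 ^ multiplicity 2 b"
  shows "t \<ge> b + 2 ^ multiplicity 2 b"
proof -
  obtain a' A' w B' where A': "tc.dimension a' N A'" and B': "tc.dimension w N B'"
    and sum: "a' + w = a + b" and 1: "1 \<in> A'" "A' \<subseteq> A" and BB: "B \<subseteq> B'" "B' \<subseteq> T"
    and stab: "\<forall>x\<in>A'. \<forall>y\<in>B'. x * y \<in> B'"
    using e_transform[OF N A(1) B(1) A(2) dimension_subspace_over[OF N T] prod] .
  note sB = subspace_overD[OF dimension_subspace_over[OF N B']]
  \<comment> \<open>The stabiliser of \<open>B'\<close> within the elements whose square lies in
    \<open>N\<close>; the condition on squares makes it a field and forces its degree over
    \<open>N\<close> to be a power of 2.\<close>
  define H where "H = {x. x\<^sup>2 \<in> N \<and> (\<forall>y\<in>B'. x * y \<in> B')}"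
  have NH: "N \<subseteq> H" using subfield_inD(6)[OF N] sB by (auto simp: H_def power2_eq_square)
  have H: "subfield_in H"
  proof (rule exponent_one_subfield[OF N NH])
    fix x y assume xy: "x \<in> H" "y \<in> H"
    show "x - y \<in> H"
      using xy subfield_inD(3)[OF N] subspace_over_diff[OF dimension_subspace_over[OF N B'] N]
      by (auto simp: H_def char2_square_add[OF two] left_diff_distrib)
    show "x * y \<in> H"
      using xy subfield_inD(6)[OF N] by (auto simp: H_def power_mult_distrib mult.assoc)
  qed (simp add: H_def)
  have "B \<noteq> {0}" using B tc.dimension_is_inj[OF N B(1)] tc.zero_dim[of N] by fastforce
  then obtain e where e: "e \<in> B'" "e \<noteq> 0"
    using subspace_overD(1)[OF dimension_subspace_over[OF N B(1)]] BB by blast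
  have sH: "subspace_over N H" using NH subfield_inD[OF H] by (auto simp: subspace_over_def)
  \<comment> \<open>The multiple \<open>e H\<close> lies inside \<open>B'\<close>, which shows that
    \<open>H\<close> is finite-dimensional over \<open>N\<close>.\<close>
  have eH: "(*) e ` H \<subseteq> B'" using e by (auto simp: H_def mult.commute)
  obtain h where h: "tc.dimension h N ((*) e ` H)"
    using subspace_has_dimension[OF N B' subspace_over_scale[OF sH] eH] .
  have "(*) (inverse e) ` (*) e ` H = H" using e by (simp add: image_image mult.assoc[symmetric])
  then have h: "tc.dimension h N H" using dimension_scale[OF h, of "inverse e"] e by simp
  obtain v where v: "h = 2 ^ v"
    using exponent_one_degree[OF two N H NH _ h] by (auto simp: H_def)
  have "A' \<subseteq> H" using 1 sq stab by (auto simp: H_def)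
  then have a': "a' \<le> 2 ^ v" using dimension_mono[OF N h A'] v by simp
  obtain c where c: "w = 2 ^ v * c"
    using tower_dimension[OF N H NH h B', of thesis] sB v by (auto simp: subspace_over_def H_def)
  have le: "b \<le> w" "w \<le> t"
    using dimension_mono[OF N B' B(1) BB(1)] dimension_mono[OF N T B' BB(2)] .
  define u where "u = multiplicity 2 b"
  have ndvd: "\<not> 2 ^ Suc u dvd b"
    using B(2) by (subst power_dvd_iff_le_multiplicity) (auto simp: u_def)
  obtain d where d: "b = 2 ^ u * d"
    using multiplicity_dvd[of 2 b] unfolding u_def by (elim dvdE)
  \<comment> \<open>This combines \<open>a' \<le> 2 ^ v\<close>, \<open>a' + w = a + b\<close> and
    \<open>a \<ge> 2 ^ u + 1\<close>.\<close>
  have ge: "w + 2 ^ v \<ge> b + 2 ^ u + 1" using sum a a' unfolding u_def by linarith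
  have "b + 2 ^ u \<le> w"
  proof (cases "v \<le> u")
    case True
    \<comment> \<open>Both \<open>w\<close> and \<open>b + 2 ^ u\<close> are multiples of
      \<open>2 ^ v\<close>, so \<open>b + 2 ^ u < w + 2 ^ v\<close> improves to
      \<open>b + 2 ^ u \<le> w\<close>.\<close>
    then obtain k where k: "u = v + k" using le_Suc_ex by blast
    have "2 ^ v * (c + 1) > 2 ^ v * (2 ^ k * (d + 1))"
      using ge by (simp add: c d k power_add algebra_simps)
    then have "c + 1 > 2 ^ k * (d + 1)" by (rule mult_less_cancel1[THEN iffD1, THEN conjunct2])
    then have "2 ^ k * (d + 1) \<le> c" by simp
    then have "2 ^ v * (2 ^ k * (d + 1)) \<le> 2 ^ v * c" by simp
    then show ?thesis by (simp add: c d k power_add algebra_simps)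
  next
    case False
    \<comment> \<open>Now \<open>2 ^ Suc u\<close> divides \<open>w\<close> but not
      \<open>b\<close>. Thus \<open>w\<close> and \<open>b\<close> are distinct multiples of
      \<open>2 ^ u\<close>, and \<open>w\<close> exceeds \<open>b\<close> by at least
      \<open>2 ^ u\<close>.\<close>
    then obtain k where k: "v = Suc u + k" using le_Suc_ex by (metis not_less_eq_eq)
    have w: "w = 2 ^ u * (2 * 2 ^ k * c)" by (simp add: c k power_add)
    then have "2 ^ Suc u dvd w" by simp
    then have "w \<noteq> b" using ndvd by auto
    then have "2 ^ u * d < 2 ^ u * (2 * 2 ^ k * c)" using w d le(1) by simp
    then have "d < 2 * 2 ^ k * c" by simp
    then have "d + 1 \<le> 2 * 2 ^ k * c" by simp
    then have "2 ^ u * (d + 1) \<le> 2 ^ u * (2 * 2 ^ k * c)" using mult_le_mono2 by blast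
    then show ?thesis using d w by simp
  qed
  then show ?thesis using le(2) unfolding u_def by simp
qed

text \<open>Dividing \<open>A\<close> and \<open>T\<close> by a nonzero \<open>s \<in> A\<close>
  arranges \<open>1 \<in> A\<close>. Dimensions are unchanged, and squares stay in \<open>N\<close>
  because \<open>s\<^sup>2 \<in> N\<close>.\<close>

lemma dimension_product_bound:
  fixes N A B T :: "'a::field set"
  assumes two: "(2::'a) = 0" and N: "subfield_in N" and A: "tc.dimension a N A"
    and B: "tc.dimension b N B" "b > 0" and T: "tc.dimension t N T"
    and sq: "\<And>x. x \<in> A \<Longrightarrow> x\<^sup>2 \<in> N" and prod: "\<And>x y. x \<in> A \<Longrightarrow> y \<in> B \<Longrightarrow> x * y \<in> T"
    and a: "a > 2 ^ multiplicity 2 b"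
  shows "t \<ge> b + 2 ^ multiplicity 2 b"
proof -
  have "A \<noteq> {0}" using a tc.dimension_is_inj[OF N A] tc.zero_dim[of N] by fastforce
  then obtain s where s: "s \<in> A" "s \<noteq> 0" using subspace_overD(1)[OF dimension_subspace_over[OF N A]] by blast
  let ?m = "(*) (inverse s)"
  have i: "inverse s \<noteq> 0" using s by simp
  show ?thesis
  proof (rule dimension_product_bound_aux[OF two N dimension_scale[OF A i] _ B dimension_scale[OF T i] _ _ a])
    show "1 \<in> ?m ` A" using s by (auto intro: image_eqI[of _ _ s])
    show "x\<^sup>2 \<in> N" if "x \<in> ?m ` A" for x
      using that sq s(1) subfield_inD(6,7)[OF N] by (auto simp: power_mult_distrib power_inverse)
    show "x * y \<in> ?m ` T" if "x \<in> ?m ` A" "y \<in> B" for x y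
      using that prod by (auto simp: mult.assoc)
  qed
qed

section \<open>Evaluation and differentiation of polynomials\<close>

lemma poly_mapping_sum_singles: "f = (\<Sum>m\<in>Poly_Mapping.keys f. Poly_Mapping.single m (Poly_Mapping.lookup f m))"
  by (rule poly_mapping_eqI) (simp add: lookup_sum lookup_single when_def sum.delta in_keys_iff)

lemma lookup_const_mult:
  fixes f :: "'a::monoid_add \<Rightarrow>\<^sub>0 'b::semiring_0"
  shows "Poly_Mapping.lookup (Poly_Mapping.single 0 c * f) m = c * Poly_Mapping.lookup f m"
  unfolding mult_map_scale_conv_mult[symmetric] by (simp add: Poly_Mapping.map.rep_eq when_def)

definition monom_eval :: "(nat \<Rightarrow> 'r::comm_monoid_mult) \<Rightarrow> (nat \<Rightarrow>\<^sub>0 nat) \<Rightarrow> 'r" where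
  "monom_eval \<theta> m = (\<Prod>i\<in>Poly_Mapping.keys m. \<theta> i ^ Poly_Mapping.lookup m i)"

lemma monom_eval_superset:
  "finite S \<Longrightarrow> Poly_Mapping.keys m \<subseteq> S \<Longrightarrow> monom_eval \<theta> m = (\<Prod>i\<in>S. \<theta> i ^ Poly_Mapping.lookup m i)"
  unfolding monom_eval_def by (rule prod.mono_neutral_left) (auto simp: in_keys_iff)

lemma monom_eval_add: "monom_eval \<theta> (m + k) = monom_eval \<theta> m * monom_eval \<theta> k"
proof -
  let ?S = "Poly_Mapping.keys m \<union> Poly_Mapping.keys k"
  show ?thesis
    by (simp add: monom_eval_superset[of ?S] keys_add power_add lookup_add prod.distrib)
qed

lemma monom_eval_zero [simp]: "monom_eval \<theta> 0 = 1"
  by (simp add: monom_eval_def)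

lemma monom_eval_single: "monom_eval \<theta> (Poly_Mapping.single i e) = \<theta> i ^ e"
  by (cases "e = 0") (auto simp: monom_eval_def)

lemma monom_eval_cong: "(\<And>i. i \<in> Poly_Mapping.keys m \<Longrightarrow> \<theta> i = \<theta>' i) \<Longrightarrow> monom_eval \<theta> m = monom_eval \<theta>' m"
  by (simp add: monom_eval_def)

text \<open>The coefficient map is a parameter because the map used later squares the coefficients,
  which is a ring homomorphism thanks to characteristic 2.\<close>

definition poly_eval ::
    "('c::zero \<Rightarrow> 'r::comm_ring_1) \<Rightarrow> (nat \<Rightarrow> 'r) \<Rightarrow> ((nat \<Rightarrow>\<^sub>0 nat) \<Rightarrow>\<^sub>0 'c) \<Rightarrow> 'r" where
  "poly_eval \<kappa> \<theta> f = (\<Sum>m\<in>Poly_Mapping.keys f. \<kappa> (Poly_Mapping.lookup f m) * monom_eval \<theta> m)"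

locale coeff_hom =
  fixes \<kappa> :: "'c::comm_ring_1 \<Rightarrow> 'r::comm_ring_1"
  assumes hom_zero: "\<kappa> 0 = 0" and hom_one: "\<kappa> 1 = 1"
    and hom_add: "\<kappa> (x + y) = \<kappa> x + \<kappa> y" and hom_mult: "\<kappa> (x * y) = \<kappa> x * \<kappa> y"
begin

lemma poly_eval_superset:
  assumes "finite S" "Poly_Mapping.keys f \<subseteq> S"
  shows "poly_eval \<kappa> \<theta> f = (\<Sum>m\<in>S. \<kappa> (Poly_Mapping.lookup f m) * monom_eval \<theta> m)"
  unfolding poly_eval_def
  by (rule sum.mono_neutral_left) (use assms in \<open>auto simp: in_keys_iff hom_zero\<close>)

lemma poly_eval_add: "poly_eval \<kappa> \<theta> (f + g) = poly_eval \<kappa> \<theta> f + poly_eval \<kappa> \<theta> g"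
proof -
  let ?S = "Poly_Mapping.keys f \<union> Poly_Mapping.keys g"
  show ?thesis
    by (simp add: poly_eval_superset[of ?S] keys_add lookup_add hom_add distrib_right sum.distrib)
qed

lemma poly_eval_zero [simp]: "poly_eval \<kappa> \<theta> 0 = 0"
  by (simp add: poly_eval_def)

lemma poly_eval_single: "poly_eval \<kappa> \<theta> (Poly_Mapping.single m c) = \<kappa> c * monom_eval \<theta> m"
  by (cases "c = 0") (auto simp: poly_eval_def hom_zero)

lemma poly_eval_one [simp]: "poly_eval \<kappa> \<theta> 1 = 1"
  using poly_eval_single[of \<theta> 0 1] by (simp add: hom_one)

lemma poly_eval_sum: "poly_eval \<kappa> \<theta> (sum f I) = (\<Sum>i\<in>I. poly_eval \<kappa> \<theta> (f i))"
  by (induct I rule: infinite_finite_induct) (auto simp: poly_eval_add)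

lemma poly_eval_mult: "poly_eval \<kappa> \<theta> (f * g) = poly_eval \<kappa> \<theta> f * poly_eval \<kappa> \<theta> g"
proof -
  let ?l = Poly_Mapping.lookup and ?s = Poly_Mapping.single
  have "f * g = (\<Sum>m\<in>Poly_Mapping.keys f. \<Sum>k\<in>Poly_Mapping.keys g. ?s (m + k) (?l f m * ?l g k))"
    using arg_cong2[OF poly_mapping_sum_singles[of f] poly_mapping_sum_singles[of g], of "(*)"]
    by (simp only: sum_product mult_single)
  then have "poly_eval \<kappa> \<theta> (f * g) =
      (\<Sum>m\<in>Poly_Mapping.keys f. \<Sum>k\<in>Poly_Mapping.keys g.
        (\<kappa> (?l f m) * monom_eval \<theta> m) * (\<kappa> (?l g k) * monom_eval \<theta> k))"
    by (simp add: poly_eval_sum poly_eval_single hom_mult monom_eval_add algebra_simps)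
  also have "\<dots> = poly_eval \<kappa> \<theta> f * poly_eval \<kappa> \<theta> g"
    by (simp add: poly_eval_def sum_product)
  finally show ?thesis .
qed

end

text \<open>For \<open>S = {..<n}\<close> this is the carrier of \<open>poly_ring n\<close>; for
  \<open>S = {1..<n}\<close> the variable of index 0 is excluded.\<close>

definition polys_in :: "nat set \<Rightarrow> ((nat \<Rightarrow>\<^sub>0 nat) \<Rightarrow>\<^sub>0 'c::zero) set" where
  "polys_in S = {f. \<forall>m\<in>Poly_Mapping.keys f. Poly_Mapping.keys m \<subseteq> S}"

lemma polys_in_zero [simp]: "0 \<in> polys_in S" by (simp add: polys_in_def)

lemma polys_in_single: "Poly_Mapping.keys m \<subseteq> S \<Longrightarrow> Poly_Mapping.single m c \<in> polys_in S"
  by (cases "c = 0") (auto simp: polys_in_def)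

lemma polys_in_one [simp]: "1 \<in> polys_in S"
  using polys_in_single[of 0 S 1] by (auto simp: polys_in_def)

lemma polys_in_add: "f \<in> polys_in S \<Longrightarrow> g \<in> polys_in S \<Longrightarrow> f + g \<in> polys_in S"
  unfolding polys_in_def using keys_add[of f g] by blast

lemma polys_in_uminus:
  fixes f :: "(nat \<Rightarrow>\<^sub>0 nat) \<Rightarrow>\<^sub>0 'c::ab_group_add"
  shows "f \<in> polys_in S \<Longrightarrow> - f \<in> polys_in S"
  by (simp add: polys_in_def in_keys_iff)

lemma polys_in_mult: "f \<in> polys_in S \<Longrightarrow> g \<in> polys_in S \<Longrightarrow> f * g \<in> polys_in S"
proof -
  assume fg: "f \<in> polys_in S" "g \<in> polys_in S"
  have "Poly_Mapping.keys m \<subseteq> S" if m: "m \<in> Poly_Mapping.keys (f * g)" for m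
  proof -
    obtain a b where "m = a + b" "a \<in> Poly_Mapping.keys f" "b \<in> Poly_Mapping.keys g"
      using m keys_mult[of f g] by blast
    then show ?thesis using fg keys_add[of a b] unfolding polys_in_def by blast
  qed
  then show ?thesis by (simp add: polys_in_def)
qed

lemma polys_in_sum: "(\<And>i. i \<in> I \<Longrightarrow> f i \<in> polys_in S) \<Longrightarrow> sum f I \<in> polys_in S"
  by (induct I rule: infinite_finite_induct) (auto simp: polys_in_add)

lemma polys_in_mono: "S \<subseteq> T \<Longrightarrow> polys_in S \<subseteq> polys_in T"
  by (auto simp: polys_in_def)

section \<open>Formal partial derivatives\<close>

definition pderiv_var :: "nat \<Rightarrow> ((nat \<Rightarrow>\<^sub>0 nat) \<Rightarrow>\<^sub>0 'c::comm_ring_1) \<Rightarrow> (nat \<Rightarrow>\<^sub>0 nat) \<Rightarrow>\<^sub>0 'c" where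
  "pderiv_var k f = (\<Sum>m\<in>Poly_Mapping.keys f.
     Poly_Mapping.single (m - Poly_Mapping.single k 1) (of_nat (Poly_Mapping.lookup m k) * Poly_Mapping.lookup f m))"

lemma pderiv_var_superset:
  assumes "finite S" "Poly_Mapping.keys f \<subseteq> S"
  shows "pderiv_var k f = (\<Sum>m\<in>S.
     Poly_Mapping.single (m - Poly_Mapping.single k 1) (of_nat (Poly_Mapping.lookup m k) * Poly_Mapping.lookup f m))"
  unfolding pderiv_var_def by (rule sum.mono_neutral_left) (use assms in \<open>auto simp: in_keys_iff\<close>)

lemma pderiv_var_add: "pderiv_var k (f + g) = pderiv_var k f + pderiv_var k g"
proof -
  let ?S = "Poly_Mapping.keys f \<union> Poly_Mapping.keys g"
  show ?thesis
    by (simp add: pderiv_var_superset[of ?S] keys_add lookup_add distrib_left single_add sum.distrib)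
qed

lemma pderiv_var_zero [simp]: "pderiv_var k 0 = 0"
  by (simp add: pderiv_var_def)

lemma pderiv_var_single:
  "pderiv_var k (Poly_Mapping.single m c) =
     Poly_Mapping.single (m - Poly_Mapping.single k 1) (of_nat (Poly_Mapping.lookup m k) * c)"
  by (cases "c = 0") (auto simp: pderiv_var_def)

lemma pderiv_var_sum: "pderiv_var k (sum f I) = (\<Sum>i\<in>I. pderiv_var k (f i))"
  by (induct I rule: infinite_finite_induct) (auto simp: pderiv_var_add)

lemma add_diff_single:
  fixes m m' :: "nat \<Rightarrow>\<^sub>0 nat"
  assumes "Poly_Mapping.lookup m k \<noteq> 0"
  shows "m + m' - Poly_Mapping.single k 1 = (m - Poly_Mapping.single k 1) + m'"
  by (rule poly_mapping_eqI) (use assms in \<open>auto simp: lookup_add lookup_minus lookup_single when_def\<close>)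

lemma pderiv_var_mult_single:
  "pderiv_var k (Poly_Mapping.single m c * Poly_Mapping.single m' c') =
     pderiv_var k (Poly_Mapping.single m c) * Poly_Mapping.single m' c'
     + Poly_Mapping.single m c * pderiv_var k (Poly_Mapping.single m' c')"
proof -
  let ?e = "Poly_Mapping.single k 1 :: nat \<Rightarrow>\<^sub>0 nat" and ?l = Poly_Mapping.lookup and ?s = Poly_Mapping.single
  \<comment> \<open>Subtraction of exponents truncates when variable \<open>k\<close> is absent from
    \<open>m\<close>, but then the factor \<open>of_nat 0\<close> makes both sides vanish.\<close>
  have 1: "?s (m - ?e + m') (of_nat (?l m k) * c * c') = ?s (m + m' - ?e) (of_nat (?l m k) * c * c')"
    using add_diff_single[of m k m'] by (cases "?l m k = 0") auto
  have 2: "?s (m + (m' - ?e)) (c * (of_nat (?l m' k) * c')) = ?s (m + m' - ?e) (c * (of_nat (?l m' k) * c'))"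
    using add_diff_single[of m' k m] by (cases "?l m' k = 0") (auto simp: add.commute)
  show ?thesis
    unfolding pderiv_var_single mult_single 1 2 single_add[symmetric]
    by (simp add: lookup_add algebra_simps)
qed

lemma pderiv_var_mult: "pderiv_var k (f * g) = pderiv_var k f * g + f * pderiv_var k g"
proof -
  let ?l = Poly_Mapping.lookup and ?s = Poly_Mapping.single
  let ?f = "\<lambda>m. ?s m (?l f m)" and ?g = "\<lambda>m. ?s m (?l g m)"
  let ?F = "Poly_Mapping.keys f" and ?G = "Poly_Mapping.keys g"
  have f: "f = sum ?f ?F" and g: "g = sum ?g ?G" by (rule poly_mapping_sum_singles)+
  have "pderiv_var k (sum ?f ?F * sum ?g ?G) =
      pderiv_var k (sum ?f ?F) * sum ?g ?G + sum ?f ?F * pderiv_var k (sum ?g ?G)"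
    by (simp only: sum_product pderiv_var_sum pderiv_var_mult_single sum.distrib)
  then show ?thesis by (simp only: f[symmetric] g[symmetric])
qed

lemma polys_in_pderiv_var: "f \<in> polys_in S \<Longrightarrow> pderiv_var k f \<in> polys_in S"
  unfolding pderiv_var_def
proof (rule polys_in_sum, rule polys_in_single)
  fix m assume "f \<in> polys_in S" "m \<in> Poly_Mapping.keys f"
  then have "Poly_Mapping.keys m \<subseteq> S" by (auto simp: polys_in_def)
  then show "Poly_Mapping.keys (m - Poly_Mapping.single k 1) \<subseteq> S"
    by (auto simp: in_keys_iff lookup_minus subset_iff)
qed

section \<open>The Frobenius image of the coordinate ring\<close>

abbreviation const_poly :: "'c::zero \<Rightarrow> (nat \<Rightarrow>\<^sub>0 nat) \<Rightarrow>\<^sub>0 'c" where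
  "const_poly c \<equiv> Poly_Mapping.single 0 c"

abbreviation var_poly :: "nat \<Rightarrow> (nat \<Rightarrow>\<^sub>0 nat) \<Rightarrow>\<^sub>0 'c::zero_neq_one" where
  "var_poly i \<equiv> Poly_Mapping.single (Poly_Mapping.single i (Suc 0)) 1"

lemma char2_square_sum:
  fixes f :: "'i \<Rightarrow> 'a::comm_ring_1"
  assumes "(2::'a) = 0"
  shows "(sum f I)\<^sup>2 = (\<Sum>i\<in>I. (f i)\<^sup>2)"
  by (induct I rule: infinite_finite_induct) (auto simp: char2_square_add[OF assms])

lemma const_poly_eq_0_iff [simp]: "const_poly c = 0 \<longleftrightarrow> c = 0"
  by (metis lookup_single_eq lookup_zero single_zero)

lemma var_poly_power:
  "(var_poly i :: (nat \<Rightarrow>\<^sub>0 nat) \<Rightarrow>\<^sub>0 'c::comm_ring_1) ^ e = Poly_Mapping.single (Poly_Mapping.single i e) 1"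
  by (induct e) (simp_all add: mult_single single_add[symmetric])

lemma prod_single_one:
  fixes g :: "'i \<Rightarrow> nat \<Rightarrow>\<^sub>0 nat"
  shows "(\<Prod>i\<in>I. Poly_Mapping.single (g i) 1) = (Poly_Mapping.single (sum g I) 1 :: (nat \<Rightarrow>\<^sub>0 nat) \<Rightarrow>\<^sub>0 'c::comm_ring_1)"
  by (induct I rule: infinite_finite_induct) (auto simp: mult_single)

lemma monom_eval_var_poly:
  "monom_eval var_poly m = (Poly_Mapping.single m 1 :: (nat \<Rightarrow>\<^sub>0 nat) \<Rightarrow>\<^sub>0 'c::comm_ring_1)"
proof -
  have "monom_eval var_poly m =
      (Poly_Mapping.single (\<Sum>i\<in>Poly_Mapping.keys m. Poly_Mapping.single i (Poly_Mapping.lookup m i)) 1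
        :: (nat \<Rightarrow>\<^sub>0 nat) \<Rightarrow>\<^sub>0 'c)"
    by (simp only: monom_eval_def var_poly_power prod_single_one)
  then show ?thesis by (simp only: poly_mapping_sum_singles[symmetric])
qed

text \<open>Linear independence over the subfield of squares: the diagonal form
  \<open>\<Sum> a\<^sub>i x\<^sub>i\<^sup>2\<close> has no nontrivial zero.\<close>

definition square_indep :: "nat \<Rightarrow> (nat \<Rightarrow> 'a::field) \<Rightarrow> bool" where
  "square_indep n a \<longleftrightarrow> (\<forall>c. (\<Sum>i<n. (c i)\<^sup>2 * a i) = 0 \<longrightarrow> (\<forall>i<n. c i = 0))"

abbreviation sq_const :: "'a::field \<Rightarrow> (nat \<Rightarrow>\<^sub>0 nat) \<Rightarrow>\<^sub>0 'a" where
  "sq_const c \<equiv> const_poly (c\<^sup>2)"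

text \<open>\<open>frob f\<close> is \<open>f\<^sup>2\<close> rewritten in the variables \<open>Y\<^sub>i = X\<^sub>i\<^sup>2\<close>: only the coefficients are squared.\<close>

definition frob :: "((nat \<Rightarrow>\<^sub>0 nat) \<Rightarrow>\<^sub>0 'a::field) \<Rightarrow> (nat \<Rightarrow>\<^sub>0 nat) \<Rightarrow>\<^sub>0 'a" where
  "frob = poly_eval sq_const var_poly"

lemma lookup_frob: "Poly_Mapping.lookup (frob f) m = (Poly_Mapping.lookup f m)\<^sup>2"
  by (simp add: frob_def poly_eval_def monom_eval_var_poly mult_single lookup_sum lookup_single when_def
      sum.delta in_keys_iff)

lemma frob_eq_0_iff [simp]: "frob f = 0 \<longleftrightarrow> f = 0"
  by (auto simp: poly_mapping_eq_iff fun_eq_iff lookup_frob)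

lemma frob_zero [simp]: "frob 0 = 0"
  by simp

lemma keys_frob [simp]: "Poly_Mapping.keys (frob f) = Poly_Mapping.keys f"
  by (auto simp: in_keys_iff lookup_frob)

context
  assumes two: "(2::'a::field) = 0"
begin

lemma two_poly: "(2 :: (nat \<Rightarrow>\<^sub>0 nat) \<Rightarrow>\<^sub>0 'a) = 0"
  using two by (metis single_numeral single_zero)

lemma sq_const_hom: "coeff_hom (sq_const :: 'a \<Rightarrow> _)"
  by unfold_locales (simp_all add: char2_square_add(1)[OF two] single_add power_mult_distrib mult_single)

lemmas frob_add = coeff_hom.poly_eval_add[OF sq_const_hom, of var_poly, folded frob_def]
  and frob_mult = coeff_hom.poly_eval_mult[OF sq_const_hom, of var_poly, folded frob_def]
  and frob_one = coeff_hom.poly_eval_one[OF sq_const_hom, of var_poly, folded frob_def]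
  and frob_sum = coeff_hom.poly_eval_sum[OF sq_const_hom, of var_poly, folded frob_def]
  and frob_single = coeff_hom.poly_eval_single[OF sq_const_hom, of var_poly, folded frob_def,
    unfolded monom_eval_var_poly]

text \<open>The factors \<open>of_nat j\<close> produced by differentiation are their own squares in
  characteristic 2. Derivatives therefore preserve the polynomials with square coefficients.\<close>

lemma pderiv_var_frob: "pderiv_var k (frob f) = frob (pderiv_var k (f :: (nat \<Rightarrow>\<^sub>0 nat) \<Rightarrow>\<^sub>0 'a))"
proof -
  have sq: "(of_nat j :: 'a)\<^sup>2 = of_nat j" for j
    by (induct j) (simp_all add: char2_square_add(1)[OF two])
  show ?thesis
    unfolding pderiv_var_def keys_frob
    by (simp add: frob_sum frob_single lookup_frob power_mult_distrib sq mult_single)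
qed

text \<open>Each monomial contributes a relation among the \<open>q i\<close> over the squares of
  the base field, so independence survives the adjunction of variables.\<close>

lemma frob_square_indep:
  assumes "square_indep m (q :: nat \<Rightarrow> 'a)" "(\<Sum>i<m. frob (g i) * const_poly (q i)) = 0" "i < m"
  shows "g i = 0"
proof (rule poly_mapping_eqI)
  fix k
  have "0 = Poly_Mapping.lookup (\<Sum>i<m. frob (g i) * const_poly (q i)) k"
    using assms(2) by simp
  also have "\<dots> = (\<Sum>i<m. (Poly_Mapping.lookup (g i) k)\<^sup>2 * q i)"
    by (simp add: lookup_sum mult.commute[of _ "const_poly _"] lookup_const_mult lookup_frob mult.commute[of "q _"])
  finally show "Poly_Mapping.lookup (g i) k = Poly_Mapping.lookup 0 k"
    using assms(1)[unfolded square_indep_def, rule_format, of "\<lambda>i. Poly_Mapping.lookup (g i) k", OF _ assms(3)]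
    by simp
qed

end

section \<open>Squaring of functions on a diagonal quadric\<close>

locale quadric_coeffs =
  fixes n :: nat and a :: "nat \<Rightarrow> 'a::field"
  assumes two: "(2::'a) = 0" and n2: "n \<ge> 2" and indep: "square_indep n a"
begin

lemma coeff_nonzero: "i < n \<Longrightarrow> a i \<noteq> 0"
proof
  assume "i < n" "a i = 0"
  then have "(\<Sum>j<n. (if j = i then 1 else 0)\<^sup>2 * a j) = 0" by (intro sum.neutral) auto
  then show False
    using indep[unfolded square_indep_def, rule_format, of "\<lambda>j. if j = i then 1 else 0", OF _ \<open>i < n\<close>] by simp
qed

text \<open>If \<open>a 1 = c\<^sup>2 * a 0\<close>, then the coefficients
  \<open>c, 1, 0, 0, ...\<close> violate \<open>square_indep\<close>, since
  \<open>c\<^sup>2 * a 0 + a 1 = 2 * a 1 = 0\<close>.\<close>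

lemma coeff_ratio_not_square: "a 1 / a 0 \<noteq> c\<^sup>2"
proof
  assume c: "a 1 / a 0 = c\<^sup>2"
  define d where "d = (\<lambda>i::nat. if i = 0 then c else if i = 1 then 1 else 0)"
  have "(\<Sum>i<n. (d i)\<^sup>2 * a i) = (\<Sum>i\<in>{0,1}. (d i)\<^sup>2 * a i)"
    by (rule sum.mono_neutral_right) (use n2 in \<open>auto simp: d_def\<close>)
  also have "\<dots> = 2 * a 1" using c coeff_nonzero[of 0] n2 by (simp add: d_def field_simps)
  finally have "d 1 = 0"
    using indep[unfolded square_indep_def, rule_format, of d 1] two n2 by simp
  then show False by (simp add: d_def)
qed

text \<open>On the quadric, \<open>X\<^sub>0\<^sup>2\<close> equals \<open>X0_sq\<close> in the variables \<open>Y\<^sub>i\<close>, so that \<open>sq_hom\<close> is squaring of functions on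
  the quadric.\<close>

definition X0_sq :: "(nat \<Rightarrow>\<^sub>0 nat) \<Rightarrow>\<^sub>0 'a" where
  "X0_sq = (\<Sum>k\<in>{1..<n}. const_poly (a k / a 0) * var_poly k)"

definition sq_hom :: "((nat \<Rightarrow>\<^sub>0 nat) \<Rightarrow>\<^sub>0 'a) \<Rightarrow> (nat \<Rightarrow>\<^sub>0 nat) \<Rightarrow>\<^sub>0 'a" where
  "sq_hom = poly_eval sq_const (\<lambda>i. if i = 0 then X0_sq else var_poly i)"

definition qpoly :: "(nat \<Rightarrow>\<^sub>0 nat) \<Rightarrow>\<^sub>0 'a" where
  "qpoly = (\<Sum>i<n. Poly_Mapping.single (Poly_Mapping.single i 2) (a i))"

sublocale sq: coeff_hom "sq_const :: 'a \<Rightarrow> _" by (rule sq_const_hom[OF two])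

lemmas sq_hom_add = sq.poly_eval_add[of "\<lambda>i. if i = 0 then X0_sq else var_poly i", folded sq_hom_def]
  and sq_hom_mult = sq.poly_eval_mult[of "\<lambda>i. if i = 0 then X0_sq else var_poly i", folded sq_hom_def]
  and sq_hom_one = sq.poly_eval_one[of "\<lambda>i. if i = 0 then X0_sq else var_poly i", folded sq_hom_def]
  and sq_hom_sum = sq.poly_eval_sum[of "\<lambda>i. if i = 0 then X0_sq else var_poly i", folded sq_hom_def]
  and sq_hom_single = sq.poly_eval_single[of "\<lambda>i. if i = 0 then X0_sq else var_poly i", folded sq_hom_def]

lemma sq_hom_const: "sq_hom (const_poly c) = sq_const c"
  by (simp add: sq_hom_single)

lemma sq_hom_var0: "sq_hom (var_poly 0) = X0_sq"
  by (simp add: sq_hom_single monom_eval_single)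

lemma sq_hom_polys:
  assumes "f \<in> polys_in {1..<n}"
  shows "sq_hom f = frob f"
proof -
  have "0 \<notin> Poly_Mapping.keys m" if "m \<in> Poly_Mapping.keys f" for m
    using assms that by (force simp: polys_in_def)
  then show ?thesis
    unfolding sq_hom_def frob_def poly_eval_def
    by (intro sum.cong refl arg_cong2[of _ _ _ _ "(*)"] monom_eval_cong) auto
qed

lemma lessThan_n: "{..<n} = insert 0 {1..<n}" using n2 by auto

lemma X0_sq_square: "X0_sq\<^sup>2 = (\<Sum>k\<in>{1..<n}. sq_const (a k / a 0) * (var_poly k)\<^sup>2)"
  unfolding X0_sq_def char2_square_sum[OF two_poly[OF two]] by (simp add: power_mult_distrib) (simp add: power2_eq_square mult_single)

text \<open>The term of index 0 equals the sum of all the others by the formula for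
  \<open>X0_sq\<^sup>2\<close>, so the two cancel in characteristic 2.\<close>

lemma sq_hom_qpoly: "sq_hom qpoly = 0"
proof -
  have "sq_hom qpoly = (\<Sum>i<n. sq_const (a i) * (if i = 0 then X0_sq else var_poly i)\<^sup>2)"
    by (simp add: qpoly_def sq_hom_sum sq_hom_single monom_eval_single cong: if_cong)
  also have "\<dots> = sq_const (a 0) * X0_sq\<^sup>2 + (\<Sum>i\<in>{1..<n}. sq_const (a i) * (var_poly i)\<^sup>2)"
    unfolding lessThan_n by simp
  also have "sq_const (a 0) * X0_sq\<^sup>2 = (\<Sum>i\<in>{1..<n}. sq_const (a i) * (var_poly i)\<^sup>2)"
    unfolding X0_sq_square sum_distrib_left mult.assoc[symmetric] mult_single
    using coeff_nonzero[of 0] n2 by (simp add: power_mult_distrib[symmetric])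
  finally show ?thesis by (simp only: char2_square_add(4)[OF two_poly[OF two]])
qed

text \<open>Division by \<open>qpoly\<close> with a remainder of degree at most 1 in
  \<open>X\<^sub>0\<close>. The set is closed under sums, so its elements can be tested monomial by
  monomial.\<close>

definition reducible_polys :: "((nat \<Rightarrow>\<^sub>0 nat) \<Rightarrow>\<^sub>0 'a) set" where
  "reducible_polys = {f. \<exists>h\<in>polys_in {..<n}. \<exists>f0\<in>polys_in {1..<n}. \<exists>f1\<in>polys_in {1..<n}.
     f = qpoly * h + f0 + var_poly 0 * f1}"

lemma reducible_add: "f \<in> reducible_polys \<Longrightarrow> g \<in> reducible_polys \<Longrightarrow> f + g \<in> reducible_polys"
proof -
  assume "f \<in> reducible_polys" "g \<in> reducible_polys"
  then obtain h f0 f1 h' g0 g1 where *: "h \<in> polys_in {..<n}" "f0 \<in> polys_in {1..<n}" "f1 \<in> polys_in {1..<n}"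
    "f = qpoly * h + f0 + var_poly 0 * f1" "h' \<in> polys_in {..<n}" "g0 \<in> polys_in {1..<n}" "g1 \<in> polys_in {1..<n}"
    "g = qpoly * h' + g0 + var_poly 0 * g1"
    unfolding reducible_polys_def by blast
  have "f + g = qpoly * (h + h') + (f0 + g0) + var_poly 0 * (f1 + g1)"
    using * by (simp add: algebra_simps)
  then show ?thesis
    unfolding reducible_polys_def using * polys_in_add by blast
qed

lemma reducible_zero: "0 \<in> reducible_polys"
  unfolding reducible_polys_def
  by (intro CollectI bexI[of _ 0]) simp_all

lemma reducible_sum: "(\<And>i. i \<in> I \<Longrightarrow> f i \<in> reducible_polys) \<Longrightarrow> sum f I \<in> reducible_polys"
  by (induct I rule: infinite_finite_induct) (auto simp: reducible_add reducible_zero)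

lemma reducible_multiple: "h \<in> polys_in {..<n} \<Longrightarrow> qpoly * h \<in> reducible_polys"
  unfolding reducible_polys_def by (intro CollectI bexI[of _ h] bexI[of _ 0]) simp_all

text \<open>Solving \<open>qpoly\<close> for \<open>X\<^sub>0\<^sup>2\<close>: modulo
  \<open>qpoly\<close>, a factor \<open>X\<^sub>0\<^sup>2\<close> is traded for squares of the other
  variables.\<close>

lemma qpoly_single:
  "Poly_Mapping.single (Poly_Mapping.single 0 2 + m) c =
     qpoly * Poly_Mapping.single m (c / a 0)
     + (\<Sum>i\<in>{1..<n}. Poly_Mapping.single (Poly_Mapping.single i 2 + m) (- (a i * c / a 0)))"
proof -
  have "qpoly * Poly_Mapping.single m (c / a 0) =
      (\<Sum>i<n. Poly_Mapping.single (Poly_Mapping.single i 2 + m) (a i * c / a 0))"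
    by (simp add: qpoly_def sum_distrib_right mult_single)
  also have "\<dots> = Poly_Mapping.single (Poly_Mapping.single 0 2 + m) c
      + (\<Sum>i\<in>{1..<n}. Poly_Mapping.single (Poly_Mapping.single i 2 + m) (a i * c / a 0))"
    unfolding lessThan_n using coeff_nonzero[of 0] n2 by simp
  finally show ?thesis by (simp add: single_uminus sum_negf)
qed

text \<open>Induction on the exponent of \<open>X\<^sub>0\<close>: \<open>qpoly_single\<close>
  lowers it while it is at least 2, and exponents 0 and 1 already give remainders.\<close>

lemma reducible_single:
  "Poly_Mapping.keys m \<subseteq> {..<n} \<Longrightarrow> Poly_Mapping.single m c \<in> reducible_polys"
proof (induct "Poly_Mapping.lookup m 0" arbitrary: m c rule: less_induct)
  case less
  show ?case
  proof (cases "Poly_Mapping.lookup m 0 \<ge> 2")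
    case True
    define m' where "m' = m - Poly_Mapping.single 0 2"
    have m: "m = Poly_Mapping.single 0 2 + m'"
      unfolding m'_def
      by (rule poly_mapping_eqI) (use True in \<open>auto simp: lookup_add lookup_minus lookup_single when_def simp del: single_numeral\<close>)
    have k': "Poly_Mapping.keys m' \<subseteq> {..<n}"
      using less.prems by (auto simp: m'_def in_keys_iff lookup_minus subset_iff)
    have "Poly_Mapping.single (Poly_Mapping.single i 2 + m') d \<in> reducible_polys" if "i \<in> {1..<n}" for i d
    proof (rule less.hyps)
      show "Poly_Mapping.lookup (Poly_Mapping.single i 2 + m') 0 < Poly_Mapping.lookup m 0"
        using that True by (simp add: m'_def lookup_add lookup_minus lookup_single when_def del: single_numeral)
      show "Poly_Mapping.keys (Poly_Mapping.single i 2 + m') \<subseteq> {..<n}"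
        using keys_add[of "Poly_Mapping.single i 2" m'] k' that by auto
    qed
    then show ?thesis
      unfolding m qpoly_single
      by (intro reducible_add reducible_multiple reducible_sum polys_in_single k')
  next
    case False
    show ?thesis
    proof (cases "Poly_Mapping.lookup m 0 = 0")
      case True
      then have "Poly_Mapping.keys m \<subseteq> {1..<n}"
        using less.prems by (auto simp: subset_iff) (metis Suc_leI in_keys_iff neq0_conv)
      then have "Poly_Mapping.single m c \<in> polys_in {1..<n}" by (rule polys_in_single)
      then show ?thesis
        unfolding reducible_polys_def
        by (intro CollectI bexI[of _ 0] bexI[of _ "Poly_Mapping.single m c"]) simp_all
    next
      case False
      with \<open>\<not> 2 \<le> _\<close> have 1: "Poly_Mapping.lookup m 0 = 1" by simp
      define m' where "m' = m - Poly_Mapping.single 0 1"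
      have m: "m = Poly_Mapping.single 0 1 + m'"
        unfolding m'_def
        by (rule poly_mapping_eqI) (use 1 in \<open>auto simp: lookup_add lookup_minus lookup_single when_def\<close>)
      have "i \<in> {1..<n}" if "i \<in> Poly_Mapping.keys m'" for i
      proof -
        have "Poly_Mapping.lookup m' 0 = 0" by (simp add: m'_def lookup_minus 1)
        then have "i \<noteq> 0" using that by (metis in_keys_iff)
        moreover have "i \<in> Poly_Mapping.keys m" using that by (auto simp: m'_def in_keys_iff lookup_minus)
        ultimately show ?thesis using less.prems by auto
      qed
      then have "Poly_Mapping.single m' c \<in> polys_in {1..<n}" by (intro polys_in_single) blast
      moreover have "Poly_Mapping.single m c = var_poly 0 * Poly_Mapping.single m' c"
        by (simp add: m mult_single)
      ultimately show ?thesis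
        unfolding reducible_polys_def
        by (intro CollectI bexI[of _ 0] bexI[of _ "Poly_Mapping.single m' c"]) simp_all
    qed
  qed
qed

lemma reduction:
  assumes "f \<in> polys_in {..<n}"
  obtains h f0 f1 where "h \<in> polys_in {..<n}" "f0 \<in> polys_in {1..<n}" "f1 \<in> polys_in {1..<n}"
    "f = qpoly * h + f0 + var_poly 0 * f1"
proof -
  have "(\<Sum>m\<in>Poly_Mapping.keys f. Poly_Mapping.single m (Poly_Mapping.lookup f m)) \<in> reducible_polys"
    using assms by (intro reducible_sum reducible_single) (simp add: polys_in_def)
  then show thesis
    using that unfolding poly_mapping_sum_singles[symmetric] reducible_polys_def by blast
qed

lemma sq_hom_reduced:
  assumes "f0 \<in> polys_in {1..<n}" "f1 \<in> polys_in {1..<n}"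
  shows "sq_hom (qpoly * h + f0 + var_poly 0 * f1) = frob f0 + X0_sq * frob f1"
  by (simp add: sq_hom_add sq_hom_mult sq_hom_qpoly sq_hom_polys[OF assms(1)] sq_hom_polys[OF assms(2)]
      sq_hom_var0)

lemma pderiv_X0_sq: "k \<in> {1..<n} \<Longrightarrow> pderiv_var k X0_sq = const_poly (a k / a 0)"
proof -
  assume k: "k \<in> {1..<n}"
  have "pderiv_var k (const_poly (a j / a 0) * var_poly j) = (if j = k then const_poly (a k / a 0) else 0)" for j
    by (simp add: mult_single pderiv_var_single lookup_single when_def)
  then show ?thesis using k by (simp add: X0_sq_def pderiv_var_sum)
qed

lemma pderiv_const_mult: "pderiv_var k (f * const_poly c) = pderiv_var k f * const_poly (c::'a)"
  by (simp add: pderiv_var_mult pderiv_var_single)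

text \<open>This is the Leibniz rule, where \<open>const_poly (q i)\<close> is constant,
  \<open>frob\<close> commutes with derivatives, and \<open>X0_sq\<close> has derivative
  \<open>a k / a 0\<close>. Here the multipliers \<open>a k / a 0\<close> enter.\<close>

lemma pderiv_relation:
  fixes m :: nat
  assumes k: "k \<in> {1..<n}"
    and eq: "X0_sq * (\<Sum>i<m. frob (g i) * const_poly (q i)) = (\<Sum>i<m. frob (f i) * const_poly (q i))"
  shows "const_poly (a k / a 0) * (\<Sum>i<m. frob (g i) * const_poly (q i)) =
    (\<Sum>i<m. frob (pderiv_var k (f i)) * const_poly (q i))
     - X0_sq * (\<Sum>i<m. frob (pderiv_var k (g i)) * const_poly (q i))"
  using arg_cong[OF eq, of "pderiv_var k"]
  by (simp add: pderiv_var_mult[of k X0_sq] pderiv_X0_sq[OF k] pderiv_var_sum pderiv_const_mult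
      pderiv_var_frob[OF two] algebra_simps)

text \<open>Differentiating with respect to \<open>Y\<^sub>1\<close>, multiplying by
  \<open>frob g\<close> and substituting \<open>frob f\<close> for \<open>X0_sq * frob g\<close>
  shows that \<open>a 1 / a 0\<close> times \<open>frob (g * g)\<close> is a value of
  \<open>frob\<close>. A nonzero coefficient of \<open>g * g\<close> then exhibits
  \<open>a 1 / a 0\<close> as a square.\<close>

lemma X0_sq_frob_eq:
  assumes "X0_sq * frob g = frob f"
  shows "g = 0"
proof (rule ccontr)
  assume "g \<noteq> 0"
  have 1: "1 \<in> {1..<n}" using n2 by simp
  \<comment> \<open>The general relation is used with a single summand and constant coefficient
    1.\<close>
  have "const_poly (a 1 / a 0) * frob g = frob (pderiv_var 1 f) - X0_sq * frob (pderiv_var 1 g)"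
    using pderiv_relation[OF 1, where m = 1 and g = "\<lambda>_. g" and q = "\<lambda>_. 1" and f = "\<lambda>_. f"] assms by simp
  from arg_cong[OF this, of "\<lambda>x. x * frob g"]
  have "const_poly (a 1 / a 0) * frob (g * g) =
      frob (pderiv_var 1 f) * frob g - (X0_sq * frob g) * frob (pderiv_var 1 g)"
    by (simp only: frob_mult[OF two] left_diff_distrib right_diff_distrib mult_ac)
  also have "\<dots> = frob (pderiv_var 1 f * g - f * pderiv_var 1 g)"
    unfolding assms
    by (simp only: frob_add[OF two] frob_mult[OF two] diff_conv_add_uminus char2_square_add(3)[OF two_poly[OF two]])
  finally have eq: "const_poly (a 1 / a 0) * frob (g * g) = frob (pderiv_var 1 f * g - f * pderiv_var 1 g)" .
  have "g * g \<noteq> 0" using \<open>g \<noteq> 0\<close> by simp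
  then obtain m where m: "Poly_Mapping.lookup (g * g) m \<noteq> 0"
    by (metis lookup_zero poly_mapping_eqI)
  have "a 1 / a 0 * (Poly_Mapping.lookup (g * g) m)\<^sup>2 =
      (Poly_Mapping.lookup (pderiv_var 1 f * g - f * pderiv_var 1 g) m)\<^sup>2"
    using arg_cong[OF eq, of "\<lambda>f. Poly_Mapping.lookup f m"] by (simp only: lookup_const_mult lookup_frob)
  then have "a 1 / a 0 = (Poly_Mapping.lookup (pderiv_var 1 f * g - f * pderiv_var 1 g) m / Poly_Mapping.lookup (g * g) m)\<^sup>2"
    using m by (simp add: power_divide eq_divide_eq)
  then show False using coeff_ratio_not_square by blast
qed

text \<open>The remainder \<open>f0 + X\<^sub>0 * f1\<close> maps to
  \<open>frob f0 + X0_sq * frob f1\<close>, and \<open>X0_sq_frob_eq\<close> forces both parts to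
  vanish. The coordinate ring of the quadric thus embeds in a polynomial ring.\<close>

lemma sq_hom_kernel:
  assumes "f \<in> polys_in {..<n}"
  shows "sq_hom f = 0 \<longleftrightarrow> (\<exists>h\<in>polys_in {..<n}. f = h * qpoly)"
proof
  assume 0: "sq_hom f = 0"
  obtain h f0 f1 where *: "h \<in> polys_in {..<n}" "f0 \<in> polys_in {1..<n}" "f1 \<in> polys_in {1..<n}"
    "f = qpoly * h + f0 + var_poly 0 * f1"
    using reduction[OF assms] .
  have e: "frob f0 + X0_sq * frob f1 = 0" using 0 *(4) sq_hom_reduced[OF *(2,3)] by simp
  then have "X0_sq * frob f1 = frob f0"
    using char2_square_add(3)[OF two_poly[OF two], of "frob f0"] by (metis add.commute eq_neg_iff_add_eq_0)
  then have "f1 = 0" by (rule X0_sq_frob_eq)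
  moreover then have "f0 = 0" using e by simp
  ultimately show "\<exists>h\<in>polys_in {..<n}. f = h * qpoly" using * by (auto simp: mult.commute)
qed (auto simp: sq_hom_mult sq_hom_qpoly)

end

section \<open>The key inequality\<close>

lemma Span_eq_sums:
  assumes K: "subfield_in K"
  shows "tc.Span K us = {\<Sum>i<length us. c i * us ! i | c. \<forall>i<length us. c i \<in> K}" (is "_ = ?R")
proof (rule subset_antisym)
  show "tc.Span K us \<subseteq> ?R"
  proof (rule Span_subset)
    show "subspace_over K ?R"
      unfolding subspace_over_def
    proof (intro conjI ballI)
      show "0 \<in> ?R"
        by (intro CollectI exI[of _ "\<lambda>_. 0"]) (simp add: subfield_inD(2)[OF K])
      fix v assume "v \<in> ?R"
      then obtain c where c: "v = (\<Sum>i<length us. c i * us ! i)" "\<forall>i<length us. c i \<in> K" by blast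
      show "k * v \<in> ?R" if "k \<in> K" for k
        by (intro CollectI exI[of _ "\<lambda>i. k * c i"])
          (use c that in \<open>simp add: sum_distrib_left mult.assoc subfield_inD(6)[OF K]\<close>)
      fix w assume "w \<in> ?R"
      then obtain d where d: "w = (\<Sum>i<length us. d i * us ! i)" "\<forall>i<length us. d i \<in> K" by blast
      show "v + w \<in> ?R"
        by (intro CollectI exI[of _ "\<lambda>i. c i + d i"])
          (use c d in \<open>simp add: sum.distrib distrib_right subfield_inD(3)[OF K]\<close>)
    qed
    show "set us \<subseteq> ?R"
    proof
      fix x assume "x \<in> set us"
      then obtain j where j: "j < length us" "x = us ! j" by (auto simp: in_set_conv_nth)
      have "(\<Sum>i<length us. (if i = j then 1 else 0) * us ! i) = (\<Sum>i<length us. if i = j then us ! i else 0)"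
        by (rule sum.cong) auto
      also have "\<dots> = x" using j by simp
      finally show "x \<in> ?R"
        by (intro CollectI exI[of _ "\<lambda>i. if i = j then 1 else 0"]) (simp add: subfield_inD(1,2)[OF K])
    qed
  qed
  show "?R \<subseteq> tc.Span K us"
  proof clarify
    fix c assume c: "\<forall>i<length us. c i \<in> K"
    have "us ! i \<in> tc.Span K us" if "i < length us" for i
      using tc.Span_base_incl[OF K, of us] nth_mem[OF that] by blast
    then show "(\<Sum>i<length us. c i * us ! i) \<in> tc.Span K us"
      using c by (intro subspace_over_sum[OF Span_subspace_over[OF K]] subspace_overD(3)[OF Span_subspace_over[OF K]]) auto
  qed
qed

lemma independentI:
  assumes K: "subfield_in K"
    and "\<And>c. \<forall>i<length us. c i \<in> K \<Longrightarrow> (\<Sum>i<length us. c i * us ! i) = 0 \<Longrightarrow> \<forall>i<length us. c i = 0"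
  shows "tc.independent K us"
  using assms(2)
proof (induct us)
  case (Cons u us)
  show ?case
  proof (rule tc.li_Cons)
    show "u \<notin> tc.Span K us"
    proof
      assume "u \<in> tc.Span K us"
      then obtain c where c: "u = (\<Sum>i<length us. c i * us ! i)" "\<forall>i<length us. c i \<in> K"
        unfolding Span_eq_sums[OF K] by blast
      define d where "d = (\<lambda>i. case i of 0 \<Rightarrow> - 1 | Suc j \<Rightarrow> c j)"
      have "(\<Sum>i<length (u # us). d i * (u # us) ! i) = 0"
        by (simp only: length_Cons sum.lessThan_Suc_shift) (simp add: d_def c(1))
      moreover have "\<forall>i<length (u # us). d i \<in> K"
        using c(2) subfield_inD(1,4)[OF K] by (auto simp: d_def split: nat.split)
      ultimately have "d 0 = 0" using Cons.prems by blast
      then show False by (simp add: d_def)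
    qed
    show "tc.independent K us"
    proof (rule Cons.hyps)
      fix c assume c: "\<forall>i<length us. c i \<in> K" "(\<Sum>i<length us. c i * us ! i) = 0"
      define d where "d = (\<lambda>i. case i of 0 \<Rightarrow> 0 | Suc j \<Rightarrow> c j)"
      have "(\<Sum>i<length (u # us). d i * (u # us) ! i) = 0"
        by (simp only: length_Cons sum.lessThan_Suc_shift) (simp add: d_def c(2))
      moreover have "\<forall>i<length (u # us). d i \<in> K"
        using c(1) subfield_inD(2)[OF K] by (auto simp: d_def split: nat.split)
      ultimately have "\<forall>i<length (u # us). d i = 0" using Cons.prems by blast
      then show "\<forall>i<length us. c i = 0" by (auto simp: d_def)
    qed
  qed simp
qed simp

section \<open>Fields of fractions and common denominators\<close>

definition fracs :: "'a::field set \<Rightarrow> 'a set" where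
  "fracs D = {x / y | x y. x \<in> D \<and> y \<in> D \<and> y \<noteq> 0}"

locale subdomain =
  fixes D :: "'a::field set"
  assumes one: "1 \<in> D" and diff: "\<And>x y. x \<in> D \<Longrightarrow> y \<in> D \<Longrightarrow> x - y \<in> D"
    and mult: "\<And>x y. x \<in> D \<Longrightarrow> y \<in> D \<Longrightarrow> x * y \<in> D"
begin

lemma zero: "0 \<in> D" using diff[OF one one] by simp

lemma fracsI: "x \<in> D \<Longrightarrow> y \<in> D \<Longrightarrow> y \<noteq> 0 \<Longrightarrow> x / y \<in> fracs D"
  unfolding fracs_def by blast

lemma subset_fracs: "D \<subseteq> fracs D"
  using fracsI[OF _ one] by fastforce

lemma subfield_in_fracs: "subfield_in (fracs D)"
proof (rule subfield_inI)
  show "1 \<in> fracs D" using one subset_fracs by blast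
  fix x assume "x \<in> fracs D"
  then obtain p q where x: "p \<in> D" "q \<in> D" "q \<noteq> 0" "x = p / q" by (auto simp: fracs_def)
  show "inverse x \<in> fracs D" if "x \<noteq> 0" using that fracsI[of q p] x by (cases "p = 0") auto
  fix y assume "y \<in> fracs D"
  then obtain r s where y: "r \<in> D" "s \<in> D" "s \<noteq> 0" "y = r / s" by (auto simp: fracs_def)
  have "x - y = (p * s - r * q) / (q * s)" using x y by (simp add: field_simps)
  then show "x - y \<in> fracs D" using x y by (simp add: fracsI diff mult)
  have "x * y = (p * r) / (q * s)" using x y by simp
  then show "x * y \<in> fracs D" using x y by (simp only: fracsI diff mult mult_eq_0_iff simp_thms)
qed

lemma common_denominator:
  assumes "finite I" "\<And>i. i \<in> I \<Longrightarrow> c i \<in> fracs D"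
  obtains d where "d \<in> D" "d \<noteq> 0" "\<And>i. i \<in> I \<Longrightarrow> d * c i \<in> D"
  using assms
proof (induct I arbitrary: thesis rule: finite_induct)
  case empty
  then show ?case using one by (metis empty_iff zero_neq_one)
next
  case (insert j I)
  obtain d where d: "d \<in> D" "d \<noteq> 0" "\<And>i. i \<in> I \<Longrightarrow> d * c i \<in> D"
    using insert.hyps(3) insert.prems(2) by blast
  obtain x y where xy: "x \<in> D" "y \<in> D" "y \<noteq> 0" "c j = x / y"
    using insert.prems(2)[of j] by (auto simp: fracs_def)
  show ?case
  proof (rule insert.prems(1)[of "y * d"])
    fix i assume "i \<in> insert j I"
    then show "y * d * c i \<in> D"
    proof
      assume "i = j"
      then have "y * d * c i = x * d" using xy by simp
      then show ?thesis using mult[OF xy(1) d(1)] by (simp only:)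
    next
      assume "i \<in> I"
      then show ?thesis using d(3) xy mult by (simp add: mult.assoc)
    qed
  qed (use d xy mult in auto)
qed

end

definition to_frac :: "'a::idom \<Rightarrow> 'a fract" where "to_frac x = Fract x 1"

lemma to_frac_simps [simp]:
  "to_frac 0 = 0" "to_frac 1 = 1" "to_frac (x + y) = to_frac x + to_frac y" "to_frac (x * y) = to_frac x * to_frac y"
  "to_frac (- x) = - to_frac x" "to_frac (x - y) = to_frac x - to_frac y" "to_frac x = 0 \<longleftrightarrow> x = 0" "to_frac x = to_frac y \<longleftrightarrow> x = y"
  by (simp_all add: to_frac_def Zero_fract_def One_fract_def eq_fract)

lemma to_frac_sum: "to_frac (sum f I) = (\<Sum>i\<in>I. to_frac (f i))"
  by (induct I rule: infinite_finite_induct) simp_all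

lemma to_frac_power: "to_frac (x ^ k) = to_frac x ^ k"
  by (induct k) simp_all

abbreviation const_frac :: "'a::field \<Rightarrow> ((nat \<Rightarrow>\<^sub>0 nat) \<Rightarrow>\<^sub>0 'a) fract" where
  "const_frac c \<equiv> to_frac (const_poly c)"

text \<open>When \<open>q\<close> lists the coefficients of the form, this is the space
  \<open>S\<close> for \<open>K = K0\<close> and the space \<open>T\<close> for
  \<open>K = K1\<close>.\<close>

definition const_frac_span ::
    "((nat \<Rightarrow>\<^sub>0 nat) \<Rightarrow>\<^sub>0 'a::field) fract set \<Rightarrow> nat \<Rightarrow> (nat \<Rightarrow> 'a) \<Rightarrow> ((nat \<Rightarrow>\<^sub>0 nat) \<Rightarrow>\<^sub>0 'a) fract set" where
  "const_frac_span K m q = tc.Span K (map (\<lambda>i. const_frac (q i)) [0..<m])"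

lemma const_frac_span_eq:
  "subfield_in K \<Longrightarrow> const_frac_span K m q = {\<Sum>i<m. c i * const_frac (q i) | c. \<forall>i<m. c i \<in> K}"
  unfolding const_frac_span_def by (subst Span_eq_sums) simp_all

lemma subspace_over_const_frac_span: "subfield_in K \<Longrightarrow> subspace_over K (const_frac_span K m q)"
  unfolding const_frac_span_def by (rule Span_subspace_over)

lemma const_frac_in_span: "subfield_in K \<Longrightarrow> i < m \<Longrightarrow> const_frac (q i) \<in> const_frac_span K m q"
  unfolding const_frac_span_def using tc.Span_base_incl[of K "map (\<lambda>i. const_frac (q i)) [0..<m]"] by auto

lemma const_frac_span_subset:
  "subspace_over K V \<Longrightarrow> (\<And>i. i < m \<Longrightarrow> const_frac (q i) \<in> V) \<Longrightarrow> const_frac_span K m q \<subseteq> V"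
  unfolding const_frac_span_def by (rule Span_subset) auto

lemma const_frac_span_dimension:
  assumes "subfield_in K"
  obtains d where "tc.dimension d K (const_frac_span K m q)"
  using tc.Span_finite_dimension[OF assms, of "map (\<lambda>i. const_frac (q i)) [0..<m]"]
  unfolding const_frac_span_def tc.finite_dimension_def over_def by auto

lemma const_frac_mult: "const_frac (x * y) = const_frac x * const_frac y"
  by (simp flip: to_frac_simps(4) add: mult_single)

section \<open>The field of squares of the function field\<close>

context quadric_coeffs
begin

lemma two_fract: "(2 :: ((nat \<Rightarrow>\<^sub>0 nat) \<Rightarrow>\<^sub>0 'a) fract) = 0"
proof -
  have "(1 + 1 :: ((nat \<Rightarrow>\<^sub>0 nat) \<Rightarrow>\<^sub>0 'a) fract) = to_frac (1 + 1)" by (simp only: to_frac_simps)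
  also have "\<dots> = 0" by (simp only: char2_square_add(4)[OF two_poly[OF two]] to_frac_simps)
  finally show ?thesis by (simp only: one_add_one)
qed

definition sq_polys :: "((nat \<Rightarrow>\<^sub>0 nat) \<Rightarrow>\<^sub>0 'a) fract set" where
  "sq_polys = (\<lambda>f. to_frac (frob f)) ` polys_in {1..<n}"

sublocale sp: subdomain sq_polys
proof
  show "1 \<in> sq_polys"
    unfolding sq_polys_def by (rule image_eqI[of _ _ 1]) (simp_all add: frob_one[OF two])
  fix x y assume "x \<in> sq_polys" "y \<in> sq_polys"
  then obtain f g where fg: "f \<in> polys_in {1..<n}" "g \<in> polys_in {1..<n}" "x = to_frac (frob f)" "y = to_frac (frob g)"
    unfolding sq_polys_def by blast
  \<comment> \<open>Differences are sums in characteristic 2, so additivity of \<open>frob\<close>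
    suffices.\<close>
  have "x - y = to_frac (frob (f + g))"
    using fg char2_square_add(3)[OF two_fract, of y] by (simp add: frob_add[OF two])
  then show "x - y \<in> sq_polys" unfolding sq_polys_def using fg polys_in_add by blast
  have "x * y = to_frac (frob (f * g))" using fg by (simp add: frob_mult[OF two])
  then show "x * y \<in> sq_polys" unfolding sq_polys_def using fg polys_in_mult by blast
qed

text \<open>\<open>K0\<close> is \<open>F\<^sup>2(Y\<^sub>1, \<dots>, Y\<^sub>n\<^sub>-\<^sub>1)\<close>, and \<open>K1\<close> is the field of squares of the function field.\<close>

definition K0 :: "((nat \<Rightarrow>\<^sub>0 nat) \<Rightarrow>\<^sub>0 'a) fract set" where "K0 = fracs sq_polys"

definition K1 :: "((nat \<Rightarrow>\<^sub>0 nat) \<Rightarrow>\<^sub>0 'a) fract set" where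
  "K1 = {k + l * to_frac X0_sq | k l. k \<in> K0 \<and> l \<in> K0}"

lemma K0: "subfield_in K0" unfolding K0_def by (rule sp.subfield_in_fracs)

lemma sq_polys_K0: "f \<in> polys_in {1..<n} \<Longrightarrow> to_frac (frob f) \<in> K0"
  using sp.subset_fracs unfolding K0_def sq_polys_def by blast

lemma square_const_K0: "const_frac (c\<^sup>2) \<in> K0"
  using sq_polys_K0[OF polys_in_single[of 0 "{1..<n}" c]] by (simp add: frob_single[OF two] mult_single)

text \<open>The coefficients of \<open>X0_sq\<^sup>2\<close> are squares: it is \<open>frob\<close>
  of the sum of the terms \<open>(a k / a 0) Y\<^sub>k\<^sup>2\<close>.\<close>

lemma X0_sq_sq_K0: "(to_frac X0_sq)\<^sup>2 \<in> K0"
proof -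
  have "X0_sq\<^sup>2 = frob (\<Sum>k\<in>{1..<n}. const_poly (a k / a 0) * (var_poly k)\<^sup>2)"
    unfolding X0_sq_square
    by (simp add: frob_sum[OF two] frob_mult[OF two] frob_single[OF two] mult_single power2_eq_square
        single_add[symmetric])
  moreover have "(\<Sum>k\<in>{1..<n}. const_poly (a k / a 0) * (var_poly k)\<^sup>2) \<in> polys_in {1..<n}"
    unfolding power2_eq_square by (intro polys_in_sum polys_in_mult polys_in_single) auto
  ultimately show ?thesis using sq_polys_K0 by (simp add: to_frac_power[symmetric])
qed

lemma X0_sq_not_K0: "to_frac X0_sq \<notin> K0"
proof
  assume "to_frac X0_sq \<in> K0"
  then obtain f g where fg: "g \<noteq> 0" "to_frac X0_sq = to_frac (frob f) / to_frac (frob g)"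
    unfolding K0_def fracs_def sq_polys_def by auto
  then have "to_frac (X0_sq * frob g) = to_frac (frob f)" by (simp add: field_simps)
  then have "X0_sq * frob g = frob f" by (simp only: to_frac_simps(8))
  then show False using X0_sq_frob_eq fg(1) by blast
qed

lemmas K1 = quadratic_extension(1)[OF two_fract K0 X0_sq_sq_K0 X0_sq_not_K0, folded K1_def]
  and dim_K1 = quadratic_extension(2)[OF two_fract K0 X0_sq_sq_K0 X0_sq_not_K0, folded K1_def]
  and K0_K1 = quadratic_extension(3)[OF two_fract K0 X0_sq_sq_K0 X0_sq_not_K0, folded K1_def]
  and X0_sq_K1 = quadratic_extension(4)[OF two_fract K0 X0_sq_sq_K0 X0_sq_not_K0, folded K1_def]

lemma sq_hom_in_K1: "f \<in> polys_in {..<n} \<Longrightarrow> to_frac (sq_hom f) \<in> K1"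
proof -
  assume "f \<in> polys_in {..<n}"
  then obtain h f0 f1 where *: "f0 \<in> polys_in {1..<n}" "f1 \<in> polys_in {1..<n}"
    "f = qpoly * h + f0 + var_poly 0 * f1" by (rule reduction)
  then have "to_frac (sq_hom f) = to_frac (frob f0) + to_frac (frob f1) * to_frac X0_sq"
    by (simp add: *(3) sq_hom_reduced[OF *(1,2)] mult.commute[of "to_frac X0_sq"])
  then show ?thesis using *(1,2) sq_polys_K0 unfolding K1_def by blast
qed

text \<open>A sum \<open>f / g + (f' / g') X0_sq\<close> is brought to the denominator
  \<open>g g'\<close>; its numerator is then the image of
  \<open>f g' + X\<^sub>0 f' g\<close>.\<close>

lemma K1_eq: "K1 = {to_frac (sq_hom f) / to_frac (sq_hom g) | f g.
    f \<in> polys_in {..<n} \<and> g \<in> polys_in {..<n} \<and> sq_hom g \<noteq> 0}" (is "_ = ?R")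
proof (intro subset_antisym subsetI)
  fix x assume "x \<in> ?R"
  then obtain f g where "f \<in> polys_in {..<n}" "g \<in> polys_in {..<n}" "x = to_frac (sq_hom f) / to_frac (sq_hom g)"
    by blast
  then show "x \<in> K1"
    using subfield_inD(6,7)[OF K1] sq_hom_in_K1 by (simp add: divide_inverse)
next
  fix x assume "x \<in> K1"
  then obtain f g f' g' where *: "f \<in> polys_in {1..<n}" "g \<in> polys_in {1..<n}"
    "f' \<in> polys_in {1..<n}" "g' \<in> polys_in {1..<n}" "g \<noteq> 0" "g' \<noteq> 0"
    "x = to_frac (frob f) / to_frac (frob g) + to_frac (frob f') / to_frac (frob g') * to_frac X0_sq"
    unfolding K1_def K0_def fracs_def sq_polys_def by auto
  have sub: "h \<in> polys_in {..<n}" if "h \<in> polys_in {1..<n}" for h :: "(nat \<Rightarrow>\<^sub>0 nat) \<Rightarrow>\<^sub>0 'a"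
  proof -
    have "{1..<n} \<subseteq> {..<n}" by auto
    from polys_in_mono[OF this] show ?thesis using that by blast
  qed
  have v: "(var_poly 0 :: (nat \<Rightarrow>\<^sub>0 nat) \<Rightarrow>\<^sub>0 'a) \<in> polys_in {..<n}"
    using n2 by (intro polys_in_single) auto
  have "x = to_frac (sq_hom (f * g' + var_poly 0 * (f' * g))) / to_frac (sq_hom (g * g'))"
    using * by (simp add: sq_hom_add sq_hom_mult sq_hom_var0 sq_hom_polys field_simps)
  moreover have "sq_hom (g * g') \<noteq> 0" using * by (simp add: sq_hom_mult sq_hom_polys)
  moreover have "f * g' + var_poly 0 * (f' * g) \<in> polys_in {..<n}" "g * g' \<in> polys_in {..<n}"
    using polys_in_add[OF polys_in_mult[OF sub[OF *(1)] sub[OF *(4)]]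
        polys_in_mult[OF v polys_in_mult[OF sub[OF *(3)] sub[OF *(2)]]]]
      polys_in_mult[OF sub[OF *(2)] sub[OF *(4)]] .
  ultimately show "x \<in> ?R" by blast
qed

text \<open>Clearing denominators turns a relation over \<open>K0\<close> into one with coefficients
  \<open>frob (g i)\<close>, to which \<open>frob_square_indep\<close> applies.\<close>

lemma dim_const_frac_span_K0:
  assumes "square_indep m q"
  shows "tc.dimension m K0 (const_frac_span K0 m q)"
proof -
  let ?us = "map (\<lambda>i. const_frac (q i)) [0..<m]"
  have "tc.independent K0 ?us"
  proof (rule independentI[OF K0])
    fix c assume c: "\<forall>i<length ?us. c i \<in> K0" "(\<Sum>i<length ?us. c i * ?us ! i) = 0"
    obtain d where "d \<in> sq_polys" and d: "d \<noteq> 0" "\<And>i. i \<in> {..<m} \<Longrightarrow> d * c i \<in> sq_polys"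
      by (rule sp.common_denominator[of "{..<m}" c]) (use c(1) in \<open>auto simp: K0_def\<close>)
    then have "\<forall>i\<in>{..<m}. \<exists>h. d * c i = to_frac (frob h)" unfolding sq_polys_def by blast
    from bchoice[OF this] obtain g where "\<forall>i\<in>{..<m}. d * c i = to_frac (frob (g i))" by blast
    then have g: "\<And>i. i < m \<Longrightarrow> d * c i = to_frac (frob (g i))" by simp
    have "to_frac (\<Sum>i<m. frob (g i) * const_poly (q i)) = (\<Sum>i<m. d * c i * const_frac (q i))"
      by (simp add: to_frac_sum g)
    also have "\<dots> = d * (\<Sum>i<m. c i * const_frac (q i))" by (simp add: sum_distrib_left mult.assoc)
    also have "\<dots> = 0" using c(2) by simp
    finally have "(\<Sum>i<m. frob (g i) * const_poly (q i)) = 0" by (simp only: to_frac_simps)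
    then have "g i = 0" if "i < m" for i using frob_square_indep[OF two assms _ that] by simp
    then show "\<forall>i<length ?us. c i = 0" using g d(1) by fastforce
  qed
  from tc.dimensionI[OF K0 this] show ?thesis by (simp add: const_frac_span_def)
qed

text \<open>Since \<open>X0_sq\<^sup>2 \<in> K0\<close>, this is \<open>S \<inter> X0_sq S\<close> for \<open>S = const_frac_span K0 m q\<close>.\<close>

definition iso_space :: "nat \<Rightarrow> (nat \<Rightarrow> 'a) \<Rightarrow> ((nat \<Rightarrow>\<^sub>0 nat) \<Rightarrow>\<^sub>0 'a) fract set" where
  "iso_space m q = {s \<in> const_frac_span K0 m q. to_frac X0_sq * s \<in> const_frac_span K0 m q}"

lemma X0_sq_nonzero: "to_frac X0_sq \<noteq> 0"
  using X0_sq_not_K0 subfield_inD(2)[OF K0] by metis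

text \<open>Multiplication by \<open>X0_sq\<close> preserves the space because
  \<open>X0_sq\<^sup>2 \<in> K0\<close>, so stability under \<open>K0\<close> extends to
  \<open>K1\<close>.\<close>

lemma subspace_over_iso_space: "subspace_over K1 (iso_space m q)"
proof -
  note S = subspace_overD[OF subspace_over_const_frac_span[OF K0, of m q]]
  show ?thesis
    unfolding subspace_over_def
  proof (intro conjI ballI)
    show "0 \<in> iso_space m q" by (simp add: iso_space_def S(1))
    fix v assume v: "v \<in> iso_space m q"
    show add: "v + w \<in> iso_space m q" if "w \<in> iso_space m q" for w
      using v that S(2) by (simp add: iso_space_def distrib_left)
    fix x assume "x \<in> K1"
    then obtain k l where kl: "k \<in> K0" "l \<in> K0" "x = k + l * to_frac X0_sq" unfolding K1_def by blast
    have "to_frac X0_sq * (to_frac X0_sq * v) \<in> const_frac_span K0 m q"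
      using S(3)[OF X0_sq_sq_K0, of v] v by (simp add: iso_space_def power2_eq_square mult.assoc)
    moreover have "to_frac X0_sq * (k * v + l * (to_frac X0_sq * v)) =
        k * (to_frac X0_sq * v) + l * (to_frac X0_sq * (to_frac X0_sq * v))"
      by (simp add: algebra_simps)
    ultimately have "k * v + l * (to_frac X0_sq * v) \<in> iso_space m q"
      using v S(2,3) kl(1,2) by (simp add: iso_space_def)
    then show "x * v \<in> iso_space m q" by (simp add: kl(3) distrib_right mult.assoc)
  qed
qed

text \<open>The sum is stable under \<open>X0_sq\<close>, again because
  \<open>X0_sq\<^sup>2 \<in> K0\<close>. The decomposition reduces the dimension of \<open>T\<close>
  to that of an intersection.\<close>

lemma const_frac_span_K1_eq:
  "const_frac_span K1 m q = {x + y | x y. x \<in> const_frac_span K0 m q \<and> y \<in> (*) (to_frac X0_sq) ` const_frac_span K0 m q}" (is "_ = ?R")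
proof (rule subset_antisym)
  note S = subspace_overD[OF subspace_over_const_frac_span[OF K0, of m q]] and T = subspace_overD[OF subspace_over_const_frac_span[OF K1, of m q]]
  have "const_frac_span K0 m q \<subseteq> const_frac_span K1 m q"
  proof (rule const_frac_span_subset)
    show "subspace_over K0 (const_frac_span K1 m q)" using T K0_K1 by (auto simp: subspace_over_def)
  qed (rule const_frac_in_span[OF K1])
  then show "?R \<subseteq> const_frac_span K1 m q" by (auto intro!: T(2) T(3)[OF X0_sq_K1])
  show "const_frac_span K1 m q \<subseteq> ?R"
  proof (rule const_frac_span_subset)
    show "subspace_over K1 ?R"
      unfolding subspace_over_def
    proof (intro conjI ballI)
      have R: "x + to_frac X0_sq * y \<in> ?R" if "x \<in> const_frac_span K0 m q" "y \<in> const_frac_span K0 m q" for x y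
        using that by blast
      show "0 \<in> ?R" using R[OF S(1) S(1)] by simp
      fix v assume "v \<in> ?R"
      then obtain x y where v: "x \<in> const_frac_span K0 m q" "y \<in> const_frac_span K0 m q" "v = x + to_frac X0_sq * y" by blast
      show "v + w \<in> ?R" if wR: "w \<in> ?R" for w
      proof -
        obtain x' y' where w: "x' \<in> const_frac_span K0 m q" "y' \<in> const_frac_span K0 m q" "w = x' + to_frac X0_sq * y'"
          using wR by blast
        show ?thesis using R[OF S(2)[OF v(1) w(1)] S(2)[OF v(2) w(2)]] by (simp add: v w algebra_simps)
      qed
      show "z * v \<in> ?R" if "z \<in> K1" for z
      proof -
        obtain k l where kl: "k \<in> K0" "l \<in> K0" "z = k + l * to_frac X0_sq"
          using \<open>z \<in> K1\<close> unfolding K1_def by blast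
        have lr: "l * (to_frac X0_sq)\<^sup>2 \<in> K0" using kl(2) X0_sq_sq_K0 by (rule subfield_inD(6)[OF K0])
        have "(k * x + (l * (to_frac X0_sq)\<^sup>2) * y) + to_frac X0_sq * (k * y + l * x) \<in> ?R"
          by (intro R S(2) S(3) kl(1,2) lr v(1,2))
        then show ?thesis by (simp add: v(3) kl(3) algebra_simps power2_eq_square)
      qed
    qed
    fix i assume "i < m"
    then have "const_frac (q i) + to_frac X0_sq * 0 \<in> ?R" using const_frac_in_span[OF K0] S(1) by blast
    then show "const_frac (q i) \<in> ?R" by simp
  qed
qed

text \<open>Over \<open>K0\<close> the sum \<open>S + X0_sq S\<close> has dimension
  \<open>2 m - k\<close>, where \<open>k\<close> is the dimension of the intersection. Both spaces
  are stable under \<open>K1\<close>, which has degree 2 over \<open>K0\<close>, so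
  \<open>2 t = 2 m - 2 j\<close>.\<close>

lemma dim_iso_space:
  assumes q: "square_indep m q" and t: "tc.dimension t K1 (const_frac_span K1 m q)"
  obtains j where "tc.dimension j K1 (iso_space m q)" "m = t + j"
proof -
  let ?S = "const_frac_span K0 m q"
  note dS = dim_const_frac_span_K0[OF q]
  have eq: "(*) (to_frac X0_sq) ` iso_space m q = ?S \<inter> (*) (to_frac X0_sq) ` ?S"
    by (auto simp: iso_space_def)
  have sub: "subspace_over K0 (iso_space m q)"
    using subspace_over_iso_space[of m q] K0_K1 by (auto simp: subspace_over_def)
  obtain k where k: "tc.dimension k K0 (iso_space m q)"
    using subspace_has_dimension[OF K0 dS sub] by (auto simp: iso_space_def)
  obtain j where j: "k = 2 * j" "tc.dimension j K1 (iso_space m q)"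
    using tower_dimension[OF K0 K1 K0_K1 dim_K1 k subspace_over_iso_space] .
  have "tc.dimension (m + m - k) K0 (const_frac_span K1 m q)"
    unfolding const_frac_span_K1_eq
    by (rule dimension_set_add[OF K0 dS dimension_scale[OF dS X0_sq_nonzero]])
      (use dimension_scale[OF k X0_sq_nonzero] eq in simp)
  then have "m + m - k = 2 * t"
    using tc.telescopic_base[OF K0 K1 dim_K1 t] tc.dimension_is_inj[OF K0] by blast
  \<comment> \<open>This excludes truncation in \<open>m + m - k\<close>.\<close>
  moreover have "k \<le> m" using dimension_mono[OF K0 dS k] by (auto simp: iso_space_def)
  ultimately have "m = t + j" using j(1) by simp
  then show thesis using that j(2) by blast
qed

text \<open>Squaring is additive, and squares of constants and of elements of \<open>K0\<close> lie
  in \<open>K0\<close>. The product bound takes this as its hypothesis on squares.\<close>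

lemma iso_space_square:
  assumes "s \<in> iso_space m q" shows "s\<^sup>2 \<in> K1"
proof -
  obtain c where c: "s = (\<Sum>i<m. c i * const_frac (q i))" "\<forall>i<m. c i \<in> K0"
    using assms unfolding iso_space_def const_frac_span_eq[OF K0] by blast
  have "(c i * const_frac (q i))\<^sup>2 \<in> K1" if "i < m" for i
  proof -
    have "c i * c i * const_frac ((q i)\<^sup>2) \<in> K0"
      using c(2) that square_const_K0 by (intro subfield_inD(6)[OF K0]) auto
    moreover have "(c i * const_frac (q i))\<^sup>2 = c i * c i * const_frac ((q i)\<^sup>2)"
      by (simp add: power2_eq_square const_frac_mult)
    ultimately show ?thesis using K0_K1 by auto
  qed
  moreover have "subspace_over K1 K1" using subfield_inD[OF K1] by (auto simp: subspace_over_def)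
  ultimately show ?thesis
    unfolding c(1) char2_square_sum[OF two_fract] by (intro subspace_over_sum) auto
qed

text \<open>Both \<open>s\<close> and \<open>X0_sq * s\<close> have coordinates in
  \<open>K0\<close>. After clearing denominators, \<open>pderiv_relation\<close> expresses
  \<open>(a k / a 0) s\<close> through elements of \<open>S\<close> and \<open>X0_sq S\<close>. For
  \<open>k = 0\<close> the multiplier is 1.\<close>

lemma coeff_mult_iso_space:
  assumes s: "s \<in> iso_space m q" and k: "k < n"
  shows "const_frac (a k / a 0) * s \<in> const_frac_span K1 m q"
proof -
  note T = subspace_overD[OF subspace_over_const_frac_span[OF K1, of m q]]
  have ST: "const_frac_span K0 m q \<subseteq> const_frac_span K1 m q"
    unfolding const_frac_span_eq[OF K0] const_frac_span_eq[OF K1] using K0_K1 by blast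
  show ?thesis
  proof (cases "k = 0")
    case True
    then show ?thesis using s ST coeff_nonzero[of 0] n2 by (auto simp: iso_space_def)
  next
    case False
    then have k1: "k \<in> {1..<n}" using k by simp
    obtain c e where c: "s = (\<Sum>i<m. c i * const_frac (q i))" "\<forall>i<m. c i \<in> K0"
      and e: "to_frac X0_sq * s = (\<Sum>i<m. e i * const_frac (q i))" "\<forall>i<m. e i \<in> K0"
      using s unfolding iso_space_def const_frac_span_eq[OF K0] by blast
    \<comment> \<open>The Boolean index merges the two coordinate families, so that one denominator
      serves both.\<close>
    define x where "x = (\<lambda>(i, b). if b then c i else e i)"
    obtain d where d: "d \<in> sq_polys" "d \<noteq> 0" "\<And>i. i \<in> {..<m} \<times> UNIV \<Longrightarrow> d * x i \<in> sq_polys"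
      by (rule sp.common_denominator[of "{..<m} \<times> (UNIV :: bool set)" x])
        (use c(2) e(2) in \<open>auto simp: x_def K0_def\<close>)
    have "d * c i \<in> sq_polys" "d * e i \<in> sq_polys" if "i < m" for i
      using d(3)[of "(i, True)"] d(3)[of "(i, False)"] that by (simp_all add: x_def)
    then have ex: "\<forall>i\<in>{..<m}. \<exists>h. h \<in> polys_in {1..<n} \<and> d * c i = to_frac (frob h)"
      "\<forall>i\<in>{..<m}. \<exists>h. h \<in> polys_in {1..<n} \<and> d * e i = to_frac (frob h)"
      unfolding sq_polys_def by blast+
    from bchoice[OF ex(1)] bchoice[OF ex(2)] obtain g f
      where "\<forall>i\<in>{..<m}. g i \<in> polys_in {1..<n} \<and> d * c i = to_frac (frob (g i))"
        "\<forall>i\<in>{..<m}. f i \<in> polys_in {1..<n} \<and> d * e i = to_frac (frob (f i))"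
      by blast
    then have g: "\<And>i. i < m \<Longrightarrow> g i \<in> polys_in {1..<n} \<and> d * c i = to_frac (frob (g i))"
      and f: "\<And>i. i < m \<Longrightarrow> f i \<in> polys_in {1..<n} \<and> d * e i = to_frac (frob (f i))"
      by simp_all
    have ds: "d * s = to_frac (\<Sum>i<m. frob (g i) * const_poly (q i))"
      using g by (simp add: c(1) sum_distrib_left to_frac_sum mult.assoc[symmetric])
    have "to_frac (X0_sq * (\<Sum>i<m. frob (g i) * const_poly (q i))) = d * (to_frac X0_sq * s)"
      by (simp add: ds[symmetric])
    also have "\<dots> = to_frac (\<Sum>i<m. frob (f i) * const_poly (q i))"
      using f unfolding e(1) by (simp add: sum_distrib_left to_frac_sum mult.assoc[symmetric])
    finally have "X0_sq * (\<Sum>i<m. frob (g i) * const_poly (q i)) = (\<Sum>i<m. frob (f i) * const_poly (q i))"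
      by (simp only: to_frac_simps(8))
    note rel = pderiv_relation[OF k1 this]
    let ?D = "\<lambda>h. to_frac (\<Sum>i<m. frob (pderiv_var k (h i)) * const_poly (q i))"
    \<comment> \<open>Derivatives stay in the variables
      \<open>Y\<^sub>1, ..., Y\<^sub>n\<^sub>-\<^sub>1\<close>, hence the new coordinates lie in
      \<open>K0\<close> again.\<close>
    have D: "?D h \<in> const_frac_span K1 m q" if "\<And>i. i < m \<Longrightarrow> h i \<in> polys_in {1..<n}" for h
      unfolding to_frac_sum using that
      by (auto intro!: subspace_over_sum[OF subspace_over_const_frac_span[OF K1]] T(3) const_frac_in_span[OF K1]
          subsetD[OF K0_K1] sq_polys_K0 polys_in_pderiv_var)
    have "const_frac (a k / a 0) * (d * s) = ?D f - to_frac X0_sq * ?D g"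
      unfolding ds using arg_cong[OF rel, of to_frac] by (simp only: to_frac_simps)
    also have "\<dots> \<in> const_frac_span K1 m q"
      by (intro subspace_over_diff[OF subspace_over_const_frac_span[OF K1] K1] T(3)[OF X0_sq_K1] D) (use f g in auto)
    finally have "const_frac (a k / a 0) * (d * s) \<in> const_frac_span K1 m q" .
    moreover have "d \<in> K1" using d(1) sp.subset_fracs K0_K1 by (auto simp: K0_def)
    ultimately have "inverse d * (const_frac (a k / a 0) * (d * s)) \<in> const_frac_span K1 m q"
      by (intro T(3)[OF subfield_inD(7)[OF K1]])
    moreover have "inverse d * (const_frac (a k / a 0) * (d * s)) = const_frac (a k / a 0) * s" using d(2) by simp
    ultimately show ?thesis by simp
  qed
qed

text \<open>In the application \<open>m - t\<close> is the isotropy index of \<open>q\<close> over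
  the function field and \<open>d\<close> the Izhboldin dimension of \<open>p\<close>. Both lower
  bounds on \<open>t\<close> come from the products of \<open>iso_space m q\<close> and
  \<open>B\<close>, which lie in \<open>T\<close>.\<close>

theorem isotropy_bounds:
  assumes q: "square_indep m q" and t: "tc.dimension t K1 (const_frac_span K1 m q)"
    and d: "tc.dimension d K1 (const_frac_span K1 n a)"
  shows "t \<le> m" "m > t \<Longrightarrow> d \<le> t"
    "m > t + 2 ^ multiplicity 2 d \<Longrightarrow> d + 2 ^ multiplicity 2 d \<le> t"
proof -
  let ?T = "const_frac_span K1 m q"
  obtain j where j: "tc.dimension j K1 (iso_space m q)" "m = t + j"
    using dim_iso_space[OF q t] .
  show "t \<le> m" using j(2) by simp
  have a0: "const_frac (a 0) \<noteq> 0" using coeff_nonzero[of 0] n2 by simp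
  have "const_frac (a 0) \<in> const_frac_span K1 n a" using n2 by (intro const_frac_in_span[OF K1]) simp
  then have "const_frac_span K1 n a \<noteq> {0}" using a0 by blast
  then have "d \<noteq> 0" using d tc.dimension_zero[OF K1, of "const_frac_span K1 n a"] by (cases "d = 0") auto
  \<comment> \<open>Normalised so as to be spanned by the \<open>a i / a 0\<close>, the multipliers
    in \<open>coeff_mult_iso_space\<close>.\<close>
  define B where "B = (*) (inverse (const_frac (a 0))) ` const_frac_span K1 n a"
  have B: "tc.dimension d K1 B" unfolding B_def using dimension_scale[OF d] a0 by simp
  have prod: "x * y \<in> ?T" if x: "x \<in> iso_space m q" and y: "y \<in> B" for x y
  proof -
    \<comment> \<open>The admissible \<open>z\<close> form a \<open>K1\<close>-subspace, so the
      generators suffice.\<close>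
    have "const_frac_span K1 n a \<subseteq> {z. inverse (const_frac (a 0)) * z * x \<in> ?T}"
    proof (rule const_frac_span_subset)
      show "subspace_over K1 {z. inverse (const_frac (a 0)) * z * x \<in> ?T}"
        using subspace_overD[OF subspace_over_const_frac_span[OF K1, of m q]]
        by (auto simp: subspace_over_def algebra_simps)
      fix i assume "i < n"
      have "const_frac (a i / a 0) * const_frac (a 0) = const_frac (a i)"
        using coeff_nonzero[of 0] n2 by (simp add: const_frac_mult[symmetric])
      then have "inverse (const_frac (a 0)) * const_frac (a i) = const_frac (a i / a 0)" using a0 by (simp add: field_simps)
      then show "const_frac (a i) \<in> {z. inverse (const_frac (a 0)) * z * x \<in> ?T}"
        using coeff_mult_iso_space[OF x \<open>i < n\<close>] by simp
    qed
    then show ?thesis using y by (auto simp: B_def mult.commute)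
  qed
  show "d \<le> t" if "m > t"
  proof -
    have "iso_space m q \<noteq> {0}"
      using that j tc.dimension_is_inj[OF K1 j(1)] tc.zero_dim[of K1] by (metis add_0_right less_irrefl)
    then obtain s where s: "s \<in> iso_space m q" "s \<noteq> 0"
      using subspace_overD(1)[OF subspace_over_iso_space] by blast
    have "(*) s ` B \<subseteq> ?T" using prod[OF s(1)] by auto
    then show ?thesis by (rule dimension_mono[OF K1 t dimension_scale[OF B s(2)]])
  qed
  show "d + 2 ^ multiplicity 2 d \<le> t" if "m > t + 2 ^ multiplicity 2 d"
    using dimension_product_bound[OF two_fract K1 j(1) B _ t iso_space_square prod] that j(2) \<open>d \<noteq> 0\<close> by auto
qed

end

section \<open>The function field\<close>

text \<open>Identities are pulled back along the injection \<open>\<Phi>\<close>; negatives and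
  inverses exist because the image is a subfield.\<close>

lemma field_by_embedding:
  fixes L (structure) and \<Phi> :: "'l \<Rightarrow> 'e::field"
  assumes inj: "inj_on \<Phi> (carrier L)"
    and cl: "\<zero> \<in> carrier L" "\<one> \<in> carrier L"
      "\<And>x y. x \<in> carrier L \<Longrightarrow> y \<in> carrier L \<Longrightarrow> x \<oplus> y \<in> carrier L"
      "\<And>x y. x \<in> carrier L \<Longrightarrow> y \<in> carrier L \<Longrightarrow> x \<otimes> y \<in> carrier L"
    and hom: "\<Phi> \<zero> = 0" "\<Phi> \<one> = 1"
      "\<And>x y. x \<in> carrier L \<Longrightarrow> y \<in> carrier L \<Longrightarrow> \<Phi> (x \<oplus> y) = \<Phi> x + \<Phi> y"
      "\<And>x y. x \<in> carrier L \<Longrightarrow> y \<in> carrier L \<Longrightarrow> \<Phi> (x \<otimes> y) = \<Phi> x * \<Phi> y"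
    and im: "subfield_in (\<Phi> ` carrier L)"
  shows "field L"
proof -
  have eq: "x = y" if "x \<in> carrier L" "y \<in> carrier L" "\<Phi> x = \<Phi> y" for x y
    using inj that by (auto simp: inj_on_def)
  have "abelian_group L"
  proof (rule abelian_groupI)
    fix x assume x: "x \<in> carrier L"
    obtain y where "y \<in> carrier L" "\<Phi> y = - \<Phi> x"
      using subfield_inD(4)[OF im, of "\<Phi> x"] x by (metis imageE imageI)
    then show "\<exists>y\<in>carrier L. y \<oplus> x = \<zero>"
      using x by (intro bexI[of _ y] eq) (simp_all add: cl hom)
  qed (auto intro!: eq simp: cl hom)
  moreover have "comm_monoid L"
    by (rule comm_monoidI) (auto intro!: eq simp: cl hom)
  ultimately have "cring L"
    by (rule cringI) (auto intro!: eq simp: cl hom distrib_right)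
  then show ?thesis
  proof (rule cring.cring_fieldI2)
    show "\<zero> \<noteq> \<one>" using hom by auto
    fix x assume x: "x \<in> carrier L" "x \<noteq> \<zero>"
    then have "\<Phi> x \<noteq> 0" using eq[OF x(1) cl(1)] hom(1) by auto
    moreover obtain y where "y \<in> carrier L" "\<Phi> y = inverse (\<Phi> x)"
      using subfield_inD(7)[OF im, of "\<Phi> x"] x(1) by (metis imageE imageI)
    ultimately show "\<exists>y\<in>carrier L. x \<otimes> y = \<one>"
      using x(1) by (intro bexI[of _ y] eq) (simp_all add: cl hom)
  qed
qed

text \<open>Evaluates the unions that define the operations of \<open>frac_field\<close> once
  independence of representatives is known.\<close>

lemma UN_UN_const:
  assumes "(a, b) \<in> X" "(c, d) \<in> Y"
    and "\<And>a' b' c' d'. (a', b') \<in> X \<Longrightarrow> (c', d') \<in> Y \<Longrightarrow> F a' b' c' d' = Z"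
  shows "(\<Union>(a, b)\<in>X. \<Union>(c, d)\<in>Y. F a b c d) = Z"
proof -
  have "(\<Union>(a, b)\<in>X. \<Union>(c, d)\<in>Y. F a b c d) = (\<Union>x\<in>X. \<Union>y\<in>Y. Z)"
    using assms(3) by (intro SUP_cong refl) (auto split: prod.splits)
  also have "\<dots> = Z" using assms(1,2) by auto
  finally show ?thesis .
qed

text \<open>The injection into a field supplies commutativity of \<open>Q\<close> and the absence of
  zero divisors.\<close>

locale frac_embedding =
  fixes Q (structure) and \<tau> :: "'r \<Rightarrow> 'e::field"
  assumes ring_Q: "ring Q" and inj: "inj_on \<tau> (carrier Q)"
    and hom_one: "\<tau> \<one> = 1"
    and hom_add: "x \<in> carrier Q \<Longrightarrow> y \<in> carrier Q \<Longrightarrow> \<tau> (x \<oplus> y) = \<tau> x + \<tau> y"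
    and hom_mult: "x \<in> carrier Q \<Longrightarrow> y \<in> carrier Q \<Longrightarrow> \<tau> (x \<otimes> y) = \<tau> x * \<tau> y"
begin

sublocale Q: ring Q by (rule ring_Q)

lemma hom_zero: "\<tau> \<zero> = 0"
  using hom_add[of \<zero> \<zero>] by (metis Q.l_zero Q.zero_closed add.right_neutral add_left_cancel)

lemma hom_eq_0_iff: "x \<in> carrier Q \<Longrightarrow> \<tau> x = 0 \<longleftrightarrow> x = \<zero>"
  using inj hom_zero by (metis Q.zero_closed inj_onD)

abbreviation "D \<equiv> carrier Q - {\<zero>}"

lemma hom_nonzero: "x \<in> D \<Longrightarrow> \<tau> x \<noteq> 0"
  using hom_eq_0_iff by auto

lemma one_D: "\<one> \<in> D"
  using hom_zero hom_one by fastforce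

lemma mult_D: "x \<in> D \<Longrightarrow> y \<in> D \<Longrightarrow> x \<otimes> y \<in> D"
  using hom_nonzero[of x] hom_nonzero[of y] hom_mult[of x y] hom_zero by force

lemma hom_eq_iff: "x \<in> carrier Q \<Longrightarrow> y \<in> carrier Q \<Longrightarrow> \<tau> x = \<tau> y \<longleftrightarrow> x = y"
  using inj by (auto simp: inj_on_def)

text \<open>Fractions can henceforth be compared through their values in the field instead of by
  cross-multiplication in \<open>Q\<close>.\<close>

lemma frac_rel_iff:
  "((a, b), (c, d)) \<in> frac_rel Q \<longleftrightarrow> a \<in> carrier Q \<and> b \<in> D \<and> c \<in> carrier Q \<and> d \<in> D \<and> \<tau> a / \<tau> b = \<tau> c / \<tau> d"
proof -
  have "a \<otimes> d = c \<otimes> b \<longleftrightarrow> \<tau> a / \<tau> b = \<tau> c / \<tau> d"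
    if "a \<in> carrier Q" "b \<in> D" "c \<in> carrier Q" "d \<in> D"
    using hom_eq_iff[of "a \<otimes> d" "c \<otimes> b"] hom_nonzero[of b] hom_nonzero[of d] that
    by (simp add: hom_mult frac_eq_eq)
  then show ?thesis unfolding frac_rel_def by blast
qed

lemma mem_fraction_iff:
  assumes "a \<in> carrier Q" "b \<in> D"
  shows "(c, d) \<in> fraction Q a b \<longleftrightarrow> c \<in> carrier Q \<and> d \<in> D \<and> \<tau> c / \<tau> d = \<tau> a / \<tau> b"
  using assms by (auto simp: fraction_def frac_rel_iff)

lemma fraction_eq:
  assumes "a \<in> carrier Q" "b \<in> D" "c \<in> carrier Q" "d \<in> D" "\<tau> a / \<tau> b = \<tau> c / \<tau> d"
  shows "fraction Q a b = fraction Q c d"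
  using assms by (auto simp: mem_fraction_iff)

lemma carrier_frac_field: "carrier (frac_field Q) = {fraction Q a b | a b. a \<in> carrier Q \<and> b \<in> D}"
  unfolding frac_field_def quotient_def fraction_def by auto

text \<open>Independent of the representative chosen by \<open>SOME\<close> only when \<open>X\<close> is a class in the field of
  fractions.\<close>

definition frac_val :: "('r \<times> 'r) set \<Rightarrow> 'e" where
  "frac_val X = (case SOME ab. ab \<in> X of (a, b) \<Rightarrow> \<tau> a / \<tau> b)"

lemma frac_val_fraction:
  assumes "a \<in> carrier Q" "b \<in> D"
  shows "frac_val (fraction Q a b) = \<tau> a / \<tau> b"
proof -
  have "(a, b) \<in> fraction Q a b" using assms by (simp add: mem_fraction_iff)
  then have "(SOME ab. ab \<in> fraction Q a b) \<in> fraction Q a b" by (rule someI)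
  then show ?thesis
    unfolding frac_val_def using assms by (auto simp: mem_fraction_iff split: prod.split)
qed

lemma mult_fraction:
  assumes "a \<in> carrier Q" "b \<in> D" "c \<in> carrier Q" "d \<in> D"
  shows "fraction Q a b \<otimes>\<^bsub>frac_field Q\<^esub> fraction Q c d = fraction Q (a \<otimes> c) (b \<otimes> d)"
proof -
  have m: "(a, b) \<in> fraction Q a b" "(c, d) \<in> fraction Q c d" using assms by (auto simp: mem_fraction_iff)
  have "fraction Q (a' \<otimes> c') (b' \<otimes> d') = fraction Q (a \<otimes> c) (b \<otimes> d)"
    if "(a', b') \<in> fraction Q a b" "(c', d') \<in> fraction Q c d" for a' b' c' d'
  proof (rule fraction_eq)
    note * = that[unfolded mem_fraction_iff[OF assms(1,2)] mem_fraction_iff[OF assms(3,4)]]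
    show "a' \<otimes> c' \<in> carrier Q" "a \<otimes> c \<in> carrier Q" "b' \<otimes> d' \<in> D" "b \<otimes> d \<in> D"
      using * assms mult_D by auto
    have "\<tau> (a' \<otimes> c') = \<tau> a' * \<tau> c'" "\<tau> (b' \<otimes> d') = \<tau> b' * \<tau> d'"
      "\<tau> (a \<otimes> c) = \<tau> a * \<tau> c" "\<tau> (b \<otimes> d) = \<tau> b * \<tau> d"
      using * assms by (auto simp: hom_mult)
    moreover have "\<tau> a' / \<tau> b' * (\<tau> c' / \<tau> d') = \<tau> a / \<tau> b * (\<tau> c / \<tau> d)" using * by simp
    ultimately show "\<tau> (a' \<otimes> c') / \<tau> (b' \<otimes> d') = \<tau> (a \<otimes> c) / \<tau> (b \<otimes> d)"
      by (simp only: times_divide_times_eq)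
  qed
  from UN_UN_const[OF m this] show ?thesis unfolding frac_field_def by simp
qed

lemma add_fraction:
  assumes "a \<in> carrier Q" "b \<in> D" "c \<in> carrier Q" "d \<in> D"
  shows "fraction Q a b \<oplus>\<^bsub>frac_field Q\<^esub> fraction Q c d = fraction Q (a \<otimes> d \<oplus> c \<otimes> b) (b \<otimes> d)"
proof -
  have m: "(a, b) \<in> fraction Q a b" "(c, d) \<in> fraction Q c d" using assms by (auto simp: mem_fraction_iff)
  have "fraction Q (a' \<otimes> d' \<oplus> c' \<otimes> b') (b' \<otimes> d') = fraction Q (a \<otimes> d \<oplus> c \<otimes> b) (b \<otimes> d)"
    if "(a', b') \<in> fraction Q a b" "(c', d') \<in> fraction Q c d" for a' b' c' d'
  proof (rule fraction_eq)
    note * = that[unfolded mem_fraction_iff[OF assms(1,2)] mem_fraction_iff[OF assms(3,4)]]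
    show "a' \<otimes> d' \<oplus> c' \<otimes> b' \<in> carrier Q" "a \<otimes> d \<oplus> c \<otimes> b \<in> carrier Q" "b' \<otimes> d' \<in> D" "b \<otimes> d \<in> D"
      using * assms mult_D by auto
    have "\<tau> (a' \<otimes> d' \<oplus> c' \<otimes> b') = \<tau> a' * \<tau> d' + \<tau> c' * \<tau> b'" "\<tau> (b' \<otimes> d') = \<tau> b' * \<tau> d'"
      "\<tau> (a \<otimes> d \<oplus> c \<otimes> b) = \<tau> a * \<tau> d + \<tau> c * \<tau> b" "\<tau> (b \<otimes> d) = \<tau> b * \<tau> d"
      using * assms by (auto simp: hom_mult hom_add)
    moreover have "\<tau> a' / \<tau> b' + \<tau> c' / \<tau> d' = \<tau> a / \<tau> b + \<tau> c / \<tau> d" using * by simp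
    moreover have "\<tau> b \<noteq> 0" "\<tau> d \<noteq> 0" "\<tau> b' \<noteq> 0" "\<tau> d' \<noteq> 0" using * assms hom_nonzero by auto
    ultimately show "\<tau> (a' \<otimes> d' \<oplus> c' \<otimes> b') / \<tau> (b' \<otimes> d') = \<tau> (a \<otimes> d \<oplus> c \<otimes> b) / \<tau> (b \<otimes> d)"
      by (simp only: add_frac_eq not_False_eq_True)
  qed
  from UN_UN_const[OF m this] show ?thesis unfolding frac_field_def by simp
qed

lemma one_frac: "\<one>\<^bsub>frac_field Q\<^esub> = fraction Q \<one> \<one>" and zero_frac: "\<zero>\<^bsub>frac_field Q\<^esub> = fraction Q \<zero> \<one>"
  by (simp_all add: frac_field_def)

lemma frac_field_cases:
  assumes "x \<in> carrier (frac_field Q)"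
  obtains a b where "a \<in> carrier Q" "b \<in> D" "x = fraction Q a b"
  using assms unfolding carrier_frac_field by blast

lemma frac_val_image: "frac_val ` carrier (frac_field Q) = fracs (\<tau> ` carrier Q)"
proof (intro subset_antisym subsetI)
  fix x assume "x \<in> frac_val ` carrier (frac_field Q)"
  then obtain y where "x = frac_val y" "y \<in> carrier (frac_field Q)" by blast
  moreover from this(2) obtain a b where "a \<in> carrier Q" "b \<in> D" "y = fraction Q a b"
    by (rule frac_field_cases)
  ultimately show "x \<in> fracs (\<tau> ` carrier Q)"
    using frac_val_fraction[of a b] hom_nonzero[of b] unfolding fracs_def by blast
next
  fix x assume "x \<in> fracs (\<tau> ` carrier Q)"
  then obtain a b where ab: "a \<in> carrier Q" "b \<in> carrier Q" "\<tau> b \<noteq> 0" "x = \<tau> a / \<tau> b"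
    unfolding fracs_def by blast
  then have b: "b \<in> D" using hom_zero by auto
  have "fraction Q a b \<in> carrier (frac_field Q)" unfolding carrier_frac_field using ab(1) b by blast
  then show "x \<in> frac_val ` carrier (frac_field Q)"
    using frac_val_fraction[OF ab(1) b] ab(4) by (metis image_eqI)
qed

lemma frac_val_mult:
  assumes "x \<in> carrier (frac_field Q)" "y \<in> carrier (frac_field Q)"
  shows "x \<otimes>\<^bsub>frac_field Q\<^esub> y \<in> carrier (frac_field Q)"
    "frac_val (x \<otimes>\<^bsub>frac_field Q\<^esub> y) = frac_val x * frac_val y"
proof -
  obtain a b where x: "a \<in> carrier Q" "b \<in> D" "x = fraction Q a b" using assms(1) by (rule frac_field_cases)
  obtain c d where y: "c \<in> carrier Q" "d \<in> D" "y = fraction Q c d" using assms(2) by (rule frac_field_cases)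
  have cl: "a \<otimes> c \<in> carrier Q" "b \<otimes> d \<in> D" using x y mult_D by auto
  show "x \<otimes>\<^bsub>frac_field Q\<^esub> y \<in> carrier (frac_field Q)"
    unfolding x(3) y(3) mult_fraction[OF x(1,2) y(1,2)] carrier_frac_field using cl by blast
  show "frac_val (x \<otimes>\<^bsub>frac_field Q\<^esub> y) = frac_val x * frac_val y"
    unfolding x(3) y(3) mult_fraction[OF x(1,2) y(1,2)] frac_val_fraction[OF cl]
      frac_val_fraction[OF x(1,2)] frac_val_fraction[OF y(1,2)]
    using x y by (simp add: hom_mult)
qed

lemma frac_val_add:
  assumes "x \<in> carrier (frac_field Q)" "y \<in> carrier (frac_field Q)"
  shows "x \<oplus>\<^bsub>frac_field Q\<^esub> y \<in> carrier (frac_field Q)"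
    "frac_val (x \<oplus>\<^bsub>frac_field Q\<^esub> y) = frac_val x + frac_val y"
proof -
  obtain a b where x: "a \<in> carrier Q" "b \<in> D" "x = fraction Q a b" using assms(1) by (rule frac_field_cases)
  obtain c d where y: "c \<in> carrier Q" "d \<in> D" "y = fraction Q c d" using assms(2) by (rule frac_field_cases)
  have cl: "a \<otimes> d \<oplus> c \<otimes> b \<in> carrier Q" "b \<otimes> d \<in> D" using x y mult_D by auto
  show "x \<oplus>\<^bsub>frac_field Q\<^esub> y \<in> carrier (frac_field Q)"
    unfolding x(3) y(3) add_fraction[OF x(1,2) y(1,2)] carrier_frac_field using cl by blast
  show "frac_val (x \<oplus>\<^bsub>frac_field Q\<^esub> y) = frac_val x + frac_val y"
    unfolding x(3) y(3) add_fraction[OF x(1,2) y(1,2)] frac_val_fraction[OF cl]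
      frac_val_fraction[OF x(1,2)] frac_val_fraction[OF y(1,2)]
    using x y hom_nonzero[of b] hom_nonzero[of d] by (simp add: hom_mult hom_add add_frac_eq)
qed

lemma frac_val_inj: "inj_on frac_val (carrier (frac_field Q))"
proof (rule inj_onI)
  fix x y assume xL: "x \<in> carrier (frac_field Q)" and yL: "y \<in> carrier (frac_field Q)"
    and eq: "frac_val x = frac_val y"
  obtain a b where x: "a \<in> carrier Q" "b \<in> D" "x = fraction Q a b" using xL by (rule frac_field_cases)
  obtain c d where y: "c \<in> carrier Q" "d \<in> D" "y = fraction Q c d" using yL by (rule frac_field_cases)
  show "x = y"
    using eq unfolding x(3) y(3) frac_val_fraction[OF x(1,2)] frac_val_fraction[OF y(1,2)]
    by (rule fraction_eq[OF x(1,2) y(1,2)])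
qed

lemma frac_val_one: "\<one>\<^bsub>frac_field Q\<^esub> \<in> carrier (frac_field Q)" "frac_val \<one>\<^bsub>frac_field Q\<^esub> = 1"
  unfolding one_frac using one_D frac_val_fraction[of \<one> \<one>] carrier_frac_field by (auto simp: hom_one)

lemma frac_val_zero: "\<zero>\<^bsub>frac_field Q\<^esub> \<in> carrier (frac_field Q)" "frac_val \<zero>\<^bsub>frac_field Q\<^esub> = 0"
  unfolding zero_frac using one_D frac_val_fraction[of \<zero> \<one>] carrier_frac_field by (auto simp: hom_zero)

lemma subfield_in_frac_val: "subfield_in (frac_val ` carrier (frac_field Q))"
proof -
  interpret T: subdomain "\<tau> ` carrier Q"
  proof
    show "1 \<in> \<tau> ` carrier Q" using hom_one by (metis Q.one_closed imageI)
    fix x y assume "x \<in> \<tau> ` carrier Q" "y \<in> \<tau> ` carrier Q"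
    then obtain a b where ab: "a \<in> carrier Q" "b \<in> carrier Q" "x = \<tau> a" "y = \<tau> b" by blast
    have "\<tau> (\<ominus> b) + \<tau> b = 0"
      using hom_add[of "\<ominus> b" b] ab by (simp add: hom_zero Q.l_neg)
    then have "\<tau> (\<ominus> b) = - \<tau> b" by (simp add: eq_neg_iff_add_eq_0)
    then have "x - y = \<tau> (a \<oplus> \<ominus> b)" using ab by (simp add: hom_add)
    then show "x - y \<in> \<tau> ` carrier Q" using ab by simp
    have "x * y = \<tau> (a \<otimes> b)" using ab by (simp add: hom_mult)
    then show "x * y \<in> \<tau> ` carrier Q" using ab by simp
  qed
  show ?thesis unfolding frac_val_image by (rule T.subfield_in_fracs)
qed

lemma field_frac_field: "field (frac_field Q)"
  by (rule field_by_embedding[OF frac_val_inj]) (simp_all add: frac_val_add frac_val_mult frac_val_one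
      frac_val_zero subfield_in_frac_val)

end

section \<open>The coordinate ring of the quadric and its embedding\<close>

lemma poly_ring_simps:
  "carrier (poly_ring n) = polys_in {..<n}" "\<zero>\<^bsub>poly_ring n\<^esub> = 0" "\<one>\<^bsub>poly_ring n\<^esub> = 1"
  "x \<oplus>\<^bsub>poly_ring n\<^esub> y = x + y" "x \<otimes>\<^bsub>poly_ring n\<^esub> y = x * y"
  by (simp_all add: poly_ring_def polys_in_def)

lemma ring_poly_ring: "ring (poly_ring n :: ((nat \<Rightarrow>\<^sub>0 nat) \<Rightarrow>\<^sub>0 'a::field) ring)"
proof (rule ringI)
  show "abelian_group (poly_ring n :: ((nat \<Rightarrow>\<^sub>0 nat) \<Rightarrow>\<^sub>0 'a) ring)"
  proof (rule abelian_groupI)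
    fix x :: "(nat \<Rightarrow>\<^sub>0 nat) \<Rightarrow>\<^sub>0 'a" assume "x \<in> carrier (poly_ring n)"
    then show "\<exists>y\<in>carrier (poly_ring n). y \<oplus>\<^bsub>poly_ring n\<^esub> x = \<zero>\<^bsub>poly_ring n\<^esub>"
      by (intro bexI[of _ "- x"]) (simp_all add: poly_ring_simps polys_in_uminus)
  qed (simp_all add: poly_ring_simps polys_in_add add_ac)
  show "monoid (poly_ring n :: ((nat \<Rightarrow>\<^sub>0 nat) \<Rightarrow>\<^sub>0 'a) ring)"
    by (rule monoidI) (simp_all add: poly_ring_simps polys_in_mult mult_ac)
qed (simp_all add: poly_ring_simps distrib_left distrib_right)

locale quadric =
  quadric_coeffs "length (chosen_basis class_ring V)" "\<lambda>i. p (chosen_basis class_ring V ! i)"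
  for V :: "('a::field, 'v, 'n) module_scheme" and p :: "'v \<Rightarrow> 'a"
begin

abbreviation "n \<equiv> length (chosen_basis class_ring V)"
abbreviation "PR \<equiv> poly_ring n :: ((nat \<Rightarrow>\<^sub>0 nat) \<Rightarrow>\<^sub>0 'a) ring"

sublocale H: ring_hom_ring PR "class_ring :: ((nat \<Rightarrow>\<^sub>0 nat) \<Rightarrow>\<^sub>0 'a) ring" sq_hom
  by (rule ring_hom_ringI2[OF ring_poly_ring class_ring.ring_axioms])
    (rule ring_hom_memI; simp add: poly_ring_simps sq_hom_mult sq_hom_add sq_hom_one)

text \<open>With the principal ideal recognised as a kernel, the homomorphism theorem embeds the
  coordinate ring.\<close>

lemma quadric_ideal_eq: "quadric_ideal V p = a_kernel PR class_ring sq_hom"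
proof -
  have q: "form_poly V p = qpoly" by (simp add: form_poly_def qpoly_def)
  have qp: "qpoly \<in> polys_in {..<n}"
    unfolding qpoly_def by (intro polys_in_sum polys_in_single) auto
  have "f \<in> quadric_ideal V p \<longleftrightarrow> (\<exists>h\<in>polys_in {..<n}. f = h * qpoly)" for f
    unfolding quadric_ideal_def cgenideal_def poly_ring_simps q mem_Collect_eq Bex_def
    by (simp only: conj_commute)
  also have "\<dots> f \<longleftrightarrow> f \<in> polys_in {..<n} \<and> sq_hom f = 0" for f
    using sq_hom_kernel[of f] polys_in_mult[OF _ qp] by metis
  finally have "f \<in> quadric_ideal V p \<longleftrightarrow> f \<in> polys_in {..<n} \<and> sq_hom f = 0" for f .
  then show ?thesis unfolding a_kernel_def' poly_ring_simps by (intro subset_antisym subsetI) simp_all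
qed

lemma quadric_ring_eq: "quadric_ring V p = PR Quot a_kernel PR class_ring sq_hom"
  by (simp add: quadric_ring_def quadric_ideal_eq)

text \<open>A homomorphism is constant on the cosets of its kernel, so the image of a coset under
  \<open>sq_hom\<close> is a singleton.\<close>

definition coset_val :: "((nat \<Rightarrow>\<^sub>0 nat) \<Rightarrow>\<^sub>0 'a) set \<Rightarrow> ((nat \<Rightarrow>\<^sub>0 nat) \<Rightarrow>\<^sub>0 'a) fract" where
  "coset_val X = to_frac (the_elem (sq_hom ` X))"

sublocale FE: frac_embedding "quadric_ring V p" coset_val
proof (rule frac_embedding.intro)
  note hom = H.the_elem_hom[folded quadric_ring_eq]
  show "ring (quadric_ring V p)"
    unfolding quadric_ring_eq by (rule ideal.quotient_is_ring[OF H.kernel_is_ideal])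
  show "inj_on coset_val (carrier (quadric_ring V p))"
    by (rule inj_onI) (simp add: coset_val_def H.the_elem_inj quadric_ring_eq)
  show "coset_val \<one>\<^bsub>quadric_ring V p\<^esub> = 1"
    using ring_hom_one[OF hom] by (simp add: coset_val_def)
  fix x y assume "x \<in> carrier (quadric_ring V p)" "y \<in> carrier (quadric_ring V p)"
  then show "coset_val (x \<oplus>\<^bsub>quadric_ring V p\<^esub> y) = coset_val x + coset_val y"
    "coset_val (x \<otimes>\<^bsub>quadric_ring V p\<^esub> y) = coset_val x * coset_val y"
    using ring_hom_add[OF hom] ring_hom_mult[OF hom] by (simp_all add: coset_val_def)
qed

abbreviation "L \<equiv> function_field V p"
abbreviation "\<Phi> \<equiv> FE.frac_val"

lemma coset_val_coset: "f \<in> polys_in {..<n} \<Longrightarrow> coset_val (quadric_ideal V p +>\<^bsub>PR\<^esub> f) = to_frac (sq_hom f)"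
  unfolding coset_val_def quadric_ideal_eq using H.the_elem_simp[of f] by (simp add: poly_ring_simps)

lemma carrier_quadric_ring:
  "carrier (quadric_ring V p) = {quadric_ideal V p +>\<^bsub>PR\<^esub> f | f. f \<in> polys_in {..<n}}"
  unfolding quadric_ring_eq quadric_ideal_eq[symmetric] FactRing_def A_RCOSETS_def' poly_ring_simps by auto

lemma coset_val_image: "coset_val ` carrier (quadric_ring V p) = (\<lambda>f. to_frac (sq_hom f)) ` polys_in {..<n}"
proof -
  have "carrier (quadric_ring V p) = (\<lambda>f. quadric_ideal V p +>\<^bsub>PR\<^esub> f) ` polys_in {..<n}"
    unfolding carrier_quadric_ring by blast
  then show ?thesis by (simp add: image_image coset_val_coset cong: image_cong)
qed

text \<open>This identifies \<open>L\<close> with \<open>K1\<close> through \<open>\<Phi>\<close>,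
  which models the squaring map from \<open>L\<close> onto \<open>L\<^sup>2\<close>.\<close>

lemma function_field_val_image: "\<Phi> ` carrier L = K1"
proof -
  let ?e = "\<lambda>f. to_frac (sq_hom f)"
  have "fracs (?e ` polys_in {..<n}) = K1"
  proof (intro subset_antisym subsetI)
    fix x assume "x \<in> fracs (?e ` polys_in {..<n})"
    then obtain f g where "f \<in> polys_in {..<n}" "g \<in> polys_in {..<n}" "?e g \<noteq> 0" "x = ?e f / ?e g"
      unfolding fracs_def by blast
    then show "x \<in> K1" unfolding K1_eq by (intro CollectI exI[of _ f] exI[of _ g]) simp
  next
    fix x assume "x \<in> K1"
    then obtain f g where "f \<in> polys_in {..<n}" "g \<in> polys_in {..<n}" "sq_hom g \<noteq> 0" "x = ?e f / ?e g"
      unfolding K1_eq by blast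
    then show "x \<in> fracs (?e ` polys_in {..<n})"
      unfolding fracs_def by (intro CollectI exI[of _ "?e f"] exI[of _ "?e g"]) simp
  qed
  then show ?thesis by (simp only: function_field_def FE.frac_val_image coset_val_image)
qed

lemma function_field_embed_val:
  "function_field_embed V p c \<in> carrier L" "\<Phi> (function_field_embed V p c) = (const_frac c)\<^sup>2"
proof -
  have c: "const_poly c \<in> polys_in {..<n}" by (rule polys_in_single) simp
  then have Q: "quadric_ideal V p +>\<^bsub>PR\<^esub> const_poly c \<in> carrier (quadric_ring V p)"
    unfolding carrier_quadric_ring by blast
  show "function_field_embed V p c \<in> carrier L"
    unfolding function_field_embed_def function_field_def FE.carrier_frac_field using Q FE.one_D by blast
  show "\<Phi> (function_field_embed V p c) = (const_frac c)\<^sup>2"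
    unfolding function_field_embed_def FE.frac_val_fraction[OF Q FE.one_D] coset_val_coset[OF c] FE.hom_one sq_hom_const
    by (simp add: const_frac_mult power2_eq_square)
qed

lemmas field_L = FE.field_frac_field[folded function_field_def]
  and L_inj = FE.frac_val_inj[folded function_field_def]
  and L_add = FE.frac_val_add[folded function_field_def]
  and L_mult = FE.frac_val_mult[folded function_field_def]
  and L_one = FE.frac_val_one[folded function_field_def]
  and L_zero = FE.frac_val_zero[folded function_field_def]

end

section \<open>Isotropy indices over the function field\<close>

context field
begin

definition unit_fun :: "nat \<Rightarrow> nat \<Rightarrow> nat \<Rightarrow> 'a" where
  "unit_fun m i = (\<lambda>j\<in>{..<m}. if j = i then \<one> else \<zero>)"

lemma func_space_simps:
  "carrier (func_space S) = S \<rightarrow>\<^sub>E carrier R"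
  "\<zero>\<^bsub>func_space S\<^esub> = (\<lambda>v\<in>S. \<zero>)"
  "f \<oplus>\<^bsub>func_space S\<^esub> g = (\<lambda>v\<in>S. f v \<oplus> g v)"
  "c \<odot>\<^bsub>func_space S\<^esub> f = (\<lambda>v\<in>S. c \<otimes> f v)"
  by (simp_all add: func_space_def)

lemma finsum_func_space:
  assumes "finite A" "f \<in> A \<rightarrow> carrier (func_space S)" "j \<in> S"
  shows "finsum (func_space S) f A j = (\<Oplus>x\<in>A. f x j)"
proof -
  interpret M: Module.module R "func_space S" by (rule func_space_is_module)
  show ?thesis
    using assms(1,2)
  proof (induct A)
    case empty
    then show ?case using assms(3) by (simp add: func_space_simps)
  next
    case (insert x A)
    have "f x j \<in> carrier R" "(\<lambda>x. f x j) \<in> A \<rightarrow> carrier R"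
      using insert.prems assms(3) by (auto simp: func_space_simps Pi_def PiE_def)
    then show ?case
      using insert assms(3) by (simp add: M.finsum_insert finsum_insert) (simp add: func_space_simps)
  qed
qed

text \<open>The unit functions form a basis, in which the coordinates of a function are its
  values.\<close>

lemma func_space_dimension:
  "vectorspace.fin_dim R (func_space {..<m})" "vectorspace.dim R (func_space {..<m}) = m"
proof -
  let ?V = "func_space {..<m}" and ?B = "unit_fun m ` {..<m}"
  have field: "field R" by unfold_locales
  have M: "Module.module R ?V" by (rule func_space_is_module)
  interpret V: vectorspace R ?V
    using field M by (simp add: vectorspace_def)
  have "unit_fun m i \<in> {..<m} \<rightarrow>\<^sub>E carrier R" for i
    unfolding unit_fun_def restrict_PiE_iff by simp
  then have B: "?B \<subseteq> carrier ?V" by (auto simp only: func_space_simps)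
  have inj: "inj_on (unit_fun m) {..<m}"
  proof (rule inj_onI)
    fix i j assume ij: "i \<in> {..<m}" "j \<in> {..<m}" "unit_fun m i = unit_fun m j"
    then have "unit_fun m i i = unit_fun m j i" by simp
    then show "i = j" using ij by (auto simp: unit_fun_def split: if_splits)
  qed
  have lc: "V.lincomb c ?B = (\<lambda>j\<in>{..<m}. c (unit_fun m j))" if c: "c \<in> ?B \<rightarrow> carrier R" for c
  proof (rule extensionalityI[of _ "{..<m}"])
    have cl: "V.lincomb c ?B \<in> carrier ?V" using B c by (rule V.lincomb_closed)
    then show "V.lincomb c ?B \<in> extensional {..<m}" by (auto simp: func_space_simps PiE_def)
    fix j assume j: "j \<in> {..<m}"
    have u: "unit_fun m i j \<in> carrier R" for i using j by (simp add: unit_fun_def)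
    have "V.lincomb c ?B j = (\<Oplus>v\<in>?B. (c v \<odot>\<^bsub>?V\<^esub> v) j)"
      unfolding V.lincomb_def
    proof (rule finsum_func_space)
      show "(\<lambda>v. c v \<odot>\<^bsub>?V\<^esub> v) \<in> ?B \<rightarrow> carrier ?V"
        using V.summands_valid[OF B c] by blast
    qed (use j in auto)
    also have "\<dots> = (\<Oplus>i\<in>{..<m}. (c (unit_fun m i) \<odot>\<^bsub>?V\<^esub> unit_fun m i) j)"
      by (rule add.finprod_reindex[OF _ inj]) (use c j u in \<open>auto simp: func_space_simps Pi_def\<close>)
    also have "\<dots> = (\<Oplus>i\<in>{..<m}. if j = i then c (unit_fun m i) else \<zero>)"
      by (rule add.finprod_cong') (use c j in \<open>auto simp: func_space_simps unit_fun_def Pi_def\<close>)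
    also have "\<dots> = c (unit_fun m j)"
      by (rule add.finprod_singleton) (use c j in auto)
    finally show "V.lincomb c ?B j = (\<lambda>j\<in>{..<m}. c (unit_fun m j)) j" using j by simp
  qed simp
  have basis: "V.basis ?B"
    unfolding V.basis_def
  proof (intro conjI B)
    show "V.lin_indpt ?B"
    proof (rule V.finite_lin_indpt2[OF _ B])
      fix c assume c: "c \<in> ?B \<rightarrow> carrier R" "V.lincomb c ?B = \<zero>\<^bsub>?V\<^esub>"
      show "\<forall>v\<in>?B. c v = \<zero>"
      proof clarify
        fix i assume i: "i < m"
        have "(\<lambda>j\<in>{..<m}. c (unit_fun m j)) i = (\<lambda>v\<in>{..<m}. \<zero>) i"
          using lc[OF c(1)] c(2) by (simp add: func_space_simps)
        then show "c (unit_fun m i) = \<zero>" using i by simp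
      qed
    qed simp
    show "V.span ?B = carrier ?V"
    proof (rule subset_antisym)
      show "V.span ?B \<subseteq> carrier ?V" using B by (rule V.span_is_subset2)
      show "carrier ?V \<subseteq> V.span ?B"
      proof
        fix f assume f: "f \<in> carrier ?V"
        define c where "c = (\<lambda>v. f (the_inv_into {..<m} (unit_fun m) v))"
        have cu: "c (unit_fun m i) = f i" if "i \<in> {..<m}" for i
          using the_inv_into_f_f[OF inj that] by (simp add: c_def)
        have c: "c \<in> ?B \<rightarrow> carrier R" using f cu by (auto simp: func_space_simps)
        have "V.lincomb c ?B = f"
          unfolding lc[OF c]
        proof (rule extensionalityI[of _ "{..<m}"])
          show "f \<in> extensional {..<m}" using f unfolding func_space_simps PiE_def by blast
        qed (simp_all add: cu)
        then show "f \<in> V.span ?B" unfolding V.finite_span[OF finite_imageI[OF finite_lessThan] B] using c by blast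
      qed
    qed
  qed
  show "V.fin_dim" unfolding V.fin_dim_def using basis[unfolded V.basis_def] by blast
  show "V.dim = m" using V.dim_basis[OF _ basis] card_image[OF inj] by simp
qed

end

context quadric
begin

lemma L_finsum:
  assumes "finite A" "f \<in> A \<rightarrow> carrier L"
  shows "finsum L f A \<in> carrier L \<and> \<Phi> (finsum L f A) = (\<Sum>x\<in>A. \<Phi> (f x))"
proof -
  interpret L: field L by (rule field_L)
  show ?thesis
    using assms by (induct A) (auto simp: L_zero L_add L.finsum_insert)
qed

lemma L_square: "x \<in> carrier L \<Longrightarrow> x [^]\<^bsub>L\<^esub> (2::nat) \<in> carrier L \<and> \<Phi> (x [^]\<^bsub>L\<^esub> (2::nat)) = (\<Phi> x)\<^sup>2"
proof -
  interpret L: field L by (rule field_L)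
  show "x \<in> carrier L \<Longrightarrow> ?thesis"
    by (simp add: numeral_2_eq_2 L_mult)
qed

lemma L_eq_iff: "x \<in> carrier L \<Longrightarrow> y \<in> carrier L \<Longrightarrow> \<Phi> x = \<Phi> y \<longleftrightarrow> x = y"
  using L_inj by (auto simp: inj_on_def)

lemma L_surj:
  assumes "k \<in> K1" obtains x where "x \<in> carrier L" "\<Phi> x = k"
proof -
  have "k \<in> \<Phi> ` carrier L" using assms unfolding function_field_val_image .
  then show thesis using that by blast
qed

lemma L_K1: "x \<in> carrier L \<Longrightarrow> \<Phi> x \<in> K1"
  using function_field_val_image by blast

text \<open>A \<open>K1\<close>-subspace as a vector space over the function field; the multiplication and the unit of the
  record play no role.\<close>

definition val_module ::
    "((nat \<Rightarrow>\<^sub>0 nat) \<Rightarrow>\<^sub>0 'a) fract set \<Rightarrow>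
     ((((nat \<Rightarrow>\<^sub>0 nat) \<Rightarrow>\<^sub>0 'a) set \<times> ((nat \<Rightarrow>\<^sub>0 nat) \<Rightarrow>\<^sub>0 'a) set) set, ((nat \<Rightarrow>\<^sub>0 nat) \<Rightarrow>\<^sub>0 'a) fract) module" where
  "val_module C = \<lparr>carrier = C, mult = (*), one = 1, zero = 0, add = (+), smult = (\<lambda>x e. \<Phi> x * e)\<rparr>"

lemma val_module_simps:
  "carrier (val_module C) = C" "\<zero>\<^bsub>val_module C\<^esub> = 0" "x \<oplus>\<^bsub>val_module C\<^esub> y = x + y"
  "l \<odot>\<^bsub>val_module C\<^esub> x = \<Phi> l * x"
  by (simp_all add: val_module_def)

lemma vectorspace_val_module:
  assumes C: "subspace_over K1 C"
  shows "vectorspace L (val_module C)"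
proof (rule vs_criteria[OF field_L])
  show "\<forall>v\<in>carrier (val_module C). \<exists>w\<in>carrier (val_module C). v \<oplus>\<^bsub>val_module C\<^esub> w = \<zero>\<^bsub>val_module C\<^esub>"
  proof
    fix v assume "v \<in> carrier (val_module C)"
    then show "\<exists>w\<in>carrier (val_module C). v \<oplus>\<^bsub>val_module C\<^esub> w = \<zero>\<^bsub>val_module C\<^esub>"
      using subspace_over_uminus[OF C K1] by (intro bexI[of _ "- v"]) (auto simp: val_module_simps)
  qed
qed (use subspace_overD[OF C] L_K1 in \<open>auto simp: val_module_simps L_mult L_add L_one distrib_left distrib_right mult.assoc add_ac\<close>)

lemma finsum_val_module:
  assumes C: "subspace_over K1 C" and "finite A" "f \<in> A \<rightarrow> C"
  shows "finsum (val_module C) f A = sum f A"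
proof -
  interpret W: vectorspace L "val_module C" by (rule vectorspace_val_module[OF C])
  show ?thesis
    using assms(2,3)
    by (induct A) (auto simp: W.M.finsum_insert val_module_simps Pi_def)
qed

text \<open>A basis listed without repetition serves both notions of dimension, since
  \<open>\<Phi>\<close> matches the scalars in \<open>L\<close> with those in
  \<open>K1\<close>.\<close>

lemma dimension_val_module:
  assumes C: "subspace_over K1 C" and fin: "vectorspace.fin_dim L (val_module C)"
  shows "tc.dimension (vectorspace.dim L (val_module C)) K1 C"
proof -
  interpret W: vectorspace L "val_module C" by (rule vectorspace_val_module[OF C])
  obtain B where B: "finite B" "W.basis B" using W.finite_basis_exists[OF fin] by blast
  then have BC: "B \<subseteq> C" unfolding W.basis_def by (simp add: val_module_simps)
  obtain us where us: "set us = B" "distinct us" using B(1) finite_distinct_list by blast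
  have lc: "W.lincomb a B = (\<Sum>i<length us. \<Phi> (a (us ! i)) * us ! i)" if a: "a \<in> B \<rightarrow> carrier L" for a
  proof -
    have "(\<lambda>v. \<Phi> (a v) * v) \<in> B \<rightarrow> C" using a BC L_K1 subspace_overD(3)[OF C] by blast
    from finsum_val_module[OF C B(1) this]
    have "W.lincomb a B = (\<Sum>v\<in>B. \<Phi> (a v) * v)" by (simp add: W.lincomb_def val_module_simps)
    also have "\<dots> = (\<Sum>i<length us. \<Phi> (a (us ! i)) * us ! i)"
      by (rule sum.reindex_bij_betw[symmetric, OF bij_betw_nth[OF us(2) refl us(1)[symmetric]]])
    finally show ?thesis .
  qed
  have "tc.independent K1 us"
  proof (rule independentI[OF K1])
    fix c assume c: "\<forall>i<length us. c i \<in> K1" "(\<Sum>i<length us. c i * us ! i) = 0"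
    have "\<forall>i\<in>{..<length us}. \<exists>x. x \<in> carrier L \<and> \<Phi> x = c i" using c(1) L_surj by (metis lessThan_iff)
    from bchoice[OF this] obtain x where x: "\<forall>i\<in>{..<length us}. x i \<in> carrier L \<and> \<Phi> (x i) = c i" by blast
    define a where "a = (\<lambda>v. x (the_inv_into {..<length us} ((!) us) v))"
    have inj: "inj_on ((!) us) {..<length us}" using us(2) by (simp add: inj_on_nth)
    have au: "a (us ! i) = x i" if "i < length us" for i
      using the_inv_into_f_f[OF inj, of i] that by (simp add: a_def)
    have a: "a \<in> B \<rightarrow> carrier L" using x au us(1) by (auto simp: in_set_conv_nth)
    have "W.lincomb a B = 0" unfolding lc[OF a] using c(2) x au by simp
    moreover have "W.lin_indpt B" using B(2) unfolding W.basis_def by simp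
    ultimately have "a \<in> B \<rightarrow> {\<zero>\<^bsub>L\<^esub>}"
      using W.not_lindepD[OF _ B(1) subset_refl a] by (simp add: val_module_simps)
    then show "\<forall>i<length us. c i = 0" using us(1) au x L_zero(2) by (force simp: Pi_iff)
  qed
  moreover have "tc.Span K1 us = C"
  proof (rule subset_antisym)
    show "tc.Span K1 us \<subseteq> C" using BC us(1) by (intro Span_subset[OF C]) simp
    show "C \<subseteq> tc.Span K1 us"
    proof
      fix x assume "x \<in> C"
      then have "x \<in> W.span B" using B(2) unfolding W.basis_def by (simp add: val_module_simps)
      then obtain a where a: "a \<in> B \<rightarrow> carrier L" "W.lincomb a B = x"
        using W.finite_in_span[OF B(1)] BC by (auto simp: val_module_simps)
      have "\<forall>i<length us. \<Phi> (a (us ! i)) \<in> K1" using a(1) us(1) L_K1 by (auto simp: Pi_iff)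
      then show "x \<in> tc.Span K1 us" unfolding Span_eq_sums[OF K1] using a(2) lc[OF a(1)] by auto
    qed
  qed
  ultimately have "tc.dimension (length us) K1 C" by (rule tc.dimensionI[OF K1])
  moreover have "W.dim = length us"
    using W.dim_basis[OF B] us distinct_card[OF us(2)] by simp
  ultimately show ?thesis by simp
qed

text \<open>The linear map \<open>h\<close> sends \<open>x\<close> to
  \<open>\<Sum> \<Phi>(x\<^sub>i) q\<^sub>i\<close> and is onto \<open>T\<close>. Since
  \<open>\<Phi>\<close> takes the value of the form at \<open>x\<close> to
  \<open>(h x)\<^sup>2\<close>, the zero set is the kernel of \<open>h\<close>, and rank-nullity
  applies.\<close>

lemma isotropy_index_over_eq:
  fixes W :: "('a, 'w, 'o) module_scheme" and q :: "'w \<Rightarrow> 'a"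
  defines "m \<equiv> length (chosen_basis class_ring W)"
  assumes t: "tc.dimension t K1 (const_frac_span K1 m (\<lambda>i. q (chosen_basis class_ring W ! i)))"
  shows "t + isotropy_index_over W q V p = m"
proof -
  let ?q = "\<lambda>i. q (chosen_basis class_ring W ! i)"
  let ?C = "const_frac_span K1 m ?q"
  interpret L: field L by (rule field_L)
  let ?S = "L.func_space {..<m}"
  have C: "subspace_over K1 ?C" by (rule subspace_over_const_frac_span[OF K1])
  have S: "Module.module L ?S" by (rule L.func_space_is_module)
  define h where "h = (\<lambda>x. \<Sum>i<m. \<Phi> (x i) * const_frac (?q i))"
  have hC: "h x \<in> ?C" if "x \<in> {..<m} \<rightarrow>\<^sub>E carrier L" for x
    using that L_K1 unfolding const_frac_span_eq[OF K1] h_def by (auto simp: PiE_iff)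
  interpret T: linear_map L ?S "val_module ?C" h
  proof (intro linear_map.intro mod_hom.intro mod_hom_axioms.intro)
    show "vectorspace L ?S" using field_L S by (simp add: vectorspace_def)
    show vsC: "vectorspace L (val_module ?C)" by (rule vectorspace_val_module[OF C])
    show "Module.module L ?S" by (rule S)
    show "Module.module L (val_module ?C)" using vsC by (simp add: vectorspace_def)
    show "h \<in> LinearCombinations.module_hom L ?S (val_module ?C)"
      unfolding LinearCombinations.module_hom_def
    proof (intro CollectI conjI allI impI)
      show "h \<in> carrier ?S \<rightarrow> carrier (val_module ?C)"
        using hC by (auto simp: L.func_space_simps val_module_simps)
      fix x y assume xy: "x \<in> carrier ?S \<and> y \<in> carrier ?S"
      then have "x i \<in> carrier L" "y i \<in> carrier L" if "i < m" for i
        using that by (auto simp: L.func_space_simps)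
      then show "h (x \<oplus>\<^bsub>?S\<^esub> y) = h x \<oplus>\<^bsub>val_module ?C\<^esub> h y"
        by (simp add: h_def L.func_space_simps val_module_simps L_add distrib_right sum.distrib)
    next
      fix r x assume rx: "r \<in> carrier L \<and> x \<in> carrier ?S"
      then have "x i \<in> carrier L" if "i < m" for i
        using that by (auto simp: L.func_space_simps)
      then show "h (r \<odot>\<^bsub>?S\<^esub> x) = r \<odot>\<^bsub>val_module ?C\<^esub> h x"
        using rx by (simp add: h_def L.func_space_simps val_module_simps L_mult sum_distrib_left mult.assoc)
    qed
  qed
  have surj: "h ` carrier ?S = carrier (val_module ?C)"
  proof (rule subset_antisym)
    show "h ` carrier ?S \<subseteq> carrier (val_module ?C)"
      using hC by (auto simp: L.func_space_simps val_module_simps)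
    show "carrier (val_module ?C) \<subseteq> h ` carrier ?S"
    proof
      fix z assume "z \<in> carrier (val_module ?C)"
      then obtain c where c: "z = (\<Sum>i<m. c i * const_frac (?q i))" "\<forall>i<m. c i \<in> K1"
        by (auto simp: val_module_simps const_frac_span_eq[OF K1])
      have "\<forall>i\<in>{..<m}. \<exists>x. x \<in> carrier L \<and> \<Phi> x = c i" using c(2) L_surj by (metis lessThan_iff)
      from bchoice[OF this] obtain x where x: "\<forall>i\<in>{..<m}. x i \<in> carrier L \<and> \<Phi> (x i) = c i" by blast
      have "z = h (restrict x {..<m})" using c(1) x by (simp add: h_def)
      then show "z \<in> h ` carrier ?S" using x by (auto simp: L.func_space_simps)
    qed
  qed
  note fd = L.func_space_dimension[of m]
  have fC: "vectorspace.fin_dim L (val_module ?C)"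
    using T.surj_fin_dim[OF fd(1) surj] .
  have dim_t: "vectorspace.dim L (val_module ?C) = t"
    using dimension_val_module[OF C fC] tc.dimension_is_inj[OF K1 _ t] by blast
  have im: "(val_module ?C)\<lparr>carrier := T.imT\<rparr> = val_module ?C"
    using T.surj_imp_imT_carrier[OF surj] by (simp add: val_module_simps val_module_def)
  have zero_iff: "ext_form class_ring W q L (function_field_embed V p) x = \<zero>\<^bsub>L\<^esub> \<longleftrightarrow> h x = 0"
    if x: "x \<in> carrier ?S" for x
  proof -
    have xi: "x i \<in> carrier L" if "i < m" for i using x that by (auto simp: L.func_space_simps)
    let ?f = "\<lambda>i. (x i [^]\<^bsub>L\<^esub> (2::nat)) \<otimes>\<^bsub>L\<^esub> function_field_embed V p (?q i)"
    have f: "?f \<in> {..<m} \<rightarrow> carrier L"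
      using xi L_square L_mult(1) function_field_embed_val(1) by blast
    have "\<Phi> (ext_form class_ring W q L (function_field_embed V p) x) = (\<Sum>i<m. \<Phi> (?f i))"
      unfolding ext_form_def m_def[symmetric] using L_finsum[OF _ f] by simp
    also have "\<dots> = (\<Sum>i<m. (\<Phi> (x i) * const_frac (?q i))\<^sup>2)"
      using xi L_square by (intro sum.cong refl)
        (simp add: L_mult(2) function_field_embed_val power_mult_distrib)
    also have "\<dots> = (h x)\<^sup>2" unfolding h_def char2_square_sum[OF two_fract] ..
    finally have "\<Phi> (ext_form class_ring W q L (function_field_embed V p) x) = (h x)\<^sup>2" .
    moreover have "ext_form class_ring W q L (function_field_embed V p) x \<in> carrier L"
      unfolding ext_form_def m_def[symmetric] using L_finsum[OF _ f] by simp
    ultimately show ?thesis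
      using L_eq_iff[OF _ L_zero(1)] L_zero(2) by (metis power_eq_0_iff zero_less_numeral)
  qed
  have "{x \<in> carrier ?S. ext_form class_ring W q L (function_field_embed V p) x = \<zero>\<^bsub>L\<^esub>} = T.kerT"
    unfolding T.ker_def using zero_iff by (auto simp: val_module_simps)
  then have "isotropy_index_over W q V p = vectorspace.dim L (?S\<lparr>carrier := T.kerT\<rparr>)"
    unfolding isotropy_index_over_def isotropy_index_def ext_space_def m_def[symmetric] by simp
  then show ?thesis
    using T.rank_nullity[OF fd(1)] unfolding im dim_t fd(2) by simp
qed

end

text \<open>The value 0 of \<open>vectorspace.dim\<close> is informative only when a finite
  generating set exists. A maximal independent subset of \<open>Z\<close> provides one, its size
  being bounded by the dimension of the whole space.\<close>

lemma (in vectorspace) zero_dim_subspace: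
  assumes fd: "fin_dim" and Z: "VectorSpace.subspace K Z V" and dim: "vectorspace.dim K (vs Z) = 0"
  shows "Z = {\<zero>\<^bsub>V\<^esub>}"
proof -
  interpret Z: vectorspace K "vs Z" by (rule subspace_is_vs[OF Z])
  have sm: "submodule K Z V" using Z by (simp add: VectorSpace.subspace_def)
  have ZV: "Z \<subseteq> carrier V" and 0: "\<zero>\<^bsub>V\<^esub> \<in> Z"
    using submodule.subset[OF sm] submodule.zero_closed[OF sm] by auto
  have "\<exists>A. finite A \<and> maximal A (\<lambda>S. S \<subseteq> carrier (vs Z) \<and> Z.lin_indpt S)"
  proof (rule maximal_exists)
    fix A assume "A \<subseteq> carrier (vs Z) \<and> Z.lin_indpt A"
    then have "A \<subseteq> carrier V" "lin_indpt A"
      using ZV span_li_not_depend(2)[OF _ sm, of A] by auto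
    then show "finite A \<and> card A \<le> dim" using li_le_dim[OF fd] by simp
  next
    show "{} \<subseteq> carrier (vs Z) \<and> Z.lin_indpt {}" by (simp add: Z.lin_dep_def)
  qed
  then obtain A where A: "finite A" "Z.basis A" using Z.max_li_is_basis by blast
  then have "A = {}" using Z.dim_basis dim by simp
  then have "carrier (vs Z) = {\<zero>\<^bsub>vs Z\<^esub>}" using A(2) Z.span_empty unfolding Z.basis_def by simp
  then show ?thesis by simp
qed

text \<open>The choice by \<open>SOME\<close> is meaningful because a finite basis can be listed
  without repetition.\<close>

lemma chosen_basis:
  assumes "vectorspace K V" "vectorspace.fin_dim K V"
  shows "distinct (chosen_basis K V)" "vectorspace.basis K V (set (chosen_basis K V))"
    "length (chosen_basis K V) = vectorspace.dim K V"
proof -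
  interpret vectorspace K V by (rule assms(1))
  obtain B where "finite B" "basis B" using finite_basis_exists[OF assms(2)] by blast
  moreover from this(1) obtain bs where "set bs = B" "distinct bs" using finite_distinct_list by blast
  ultimately have "\<exists>bs. distinct bs \<and> basis (set bs)" by blast
  from someI_ex[OF this] show 1: "distinct (chosen_basis K V)" and 2: "basis (set (chosen_basis K V))"
    by (simp_all add: chosen_basis_def)
  show "length (chosen_basis K V) = dim"
    using dim_basis[OF _ 2] distinct_card[OF 1] by simp
qed

text \<open>A relation with coefficients \<open>(c i)\<^sup>2\<close> says that the vector with
  coordinates \<open>c i\<close> is a zero of \<open>\<phi>\<close>. Anisotropy makes this vector 0,
  and the basis property makes the \<open>c i\<close> vanish.\<close>

lemma anisotropic_square_indep:
  fixes V :: "('F::field, 'v) module" and \<phi> :: "'v \<Rightarrow> 'F"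
  assumes form: "quasilinear_form class_ring V \<phi>" and "anisotropic class_ring V \<phi>"
  shows "square_indep (length (chosen_basis class_ring V)) (\<lambda>i. \<phi> (chosen_basis class_ring V ! i))"
proof -
  have vs: "vectorspace class_ring V" and fd: "vectorspace.fin_dim class_ring V"
    and lin: "\<And>c v w. v \<in> carrier V \<Longrightarrow> w \<in> carrier V \<Longrightarrow> \<phi> (c \<odot>\<^bsub>V\<^esub> v \<oplus>\<^bsub>V\<^esub> w) = c\<^sup>2 * \<phi> v + \<phi> w"
    using form by (auto simp: quasilinear_form_def class_ring_simps)
  interpret V: vectorspace "class_ring :: 'F ring" V by (rule vs)
  let ?bs = "chosen_basis class_ring V"
  note bs = chosen_basis[OF vs fd]
  have bsV: "set ?bs \<subseteq> carrier V" using bs(2) unfolding V.basis_def by simp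
  have \<phi>0: "\<phi> \<zero>\<^bsub>V\<^esub> = 0"
  proof -
    have "\<phi> \<zero>\<^bsub>V\<^esub> = \<phi> \<zero>\<^bsub>V\<^esub> + \<phi> \<zero>\<^bsub>V\<^esub>"
      using lin[of "\<zero>\<^bsub>V\<^esub>" "\<zero>\<^bsub>V\<^esub>" 1] by (simp del: add_cancel_left_left add_cancel_left_right add_cancel_right_left add_cancel_right_right)
    then show ?thesis by (metis add_cancel_right_right)
  qed
  have sm: "\<phi> (c \<odot>\<^bsub>V\<^esub> v) = c\<^sup>2 * \<phi> v" if "v \<in> carrier V" for c v
    using lin[OF that, of "\<zero>\<^bsub>V\<^esub>" c] that \<phi>0 by simp
  have add: "\<phi> (v \<oplus>\<^bsub>V\<^esub> w) = \<phi> v + \<phi> w" if "v \<in> carrier V" "w \<in> carrier V" for v w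
    using lin[OF that, of 1] V.smult_one[OF that(1)] by simp
  let ?Z = "{v \<in> carrier V. \<phi> v = \<zero>\<^bsub>class_ring\<^esub>}"
  have "submodule class_ring ?Z V"
    by (rule submodule.intro) (use V.module_axioms sm add \<phi>0 in auto)
  then have Z: "?Z = {\<zero>\<^bsub>V\<^esub>}"
    using V.zero_dim_subspace[OF fd, of ?Z] assms(2) vs
    by (simp add: VectorSpace.subspace_def anisotropic_def isotropy_index_def)
  have sum: "\<phi> (V.lincomb c A) = (\<Sum>v\<in>A. (c v)\<^sup>2 * \<phi> v)" if "finite A" "A \<subseteq> carrier V" for c A
    using that
  proof (induct A)
    case empty
    then show ?case using \<phi>0 by (simp add: V.lincomb_def)
  next
    case (insert x A)
    then have "V.lincomb c (insert x A) = c x \<odot>\<^bsub>V\<^esub> x \<oplus>\<^bsub>V\<^esub> V.lincomb c A"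
      unfolding V.lincomb_def by (intro V.M.finsum_insert) auto
    moreover have "V.lincomb c A \<in> carrier V" using insert by (intro V.lincomb_closed) auto
    ultimately show ?case using insert lin by simp
  qed
  show ?thesis
    unfolding square_indep_def
  proof (intro allI impI)
    fix c :: "nat \<Rightarrow> 'F" and i
    assume 0: "(\<Sum>i<length ?bs. (c i)\<^sup>2 * \<phi> (?bs ! i)) = 0" and i: "i < length ?bs"
    have inj: "inj_on ((!) ?bs) {..<length ?bs}" using bs(1) by (simp add: inj_on_nth)
    define e where "e = (\<lambda>v. c (the_inv_into {..<length ?bs} ((!) ?bs) v))"
    have e: "e (?bs ! i) = c i" if "i < length ?bs" for i
      using the_inv_into_f_f[OF inj, of i] that by (simp add: e_def)
    have "\<phi> (V.lincomb e (set ?bs)) = (\<Sum>v\<in>set ?bs. (e v)\<^sup>2 * \<phi> v)" using bsV by (intro sum) auto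
    also have "\<dots> = (\<Sum>i<length ?bs. (e (?bs ! i))\<^sup>2 * \<phi> (?bs ! i))"
      by (rule sum.reindex_bij_betw[symmetric, OF bij_betw_nth[OF bs(1) refl refl]])
    also have "\<dots> = 0" using 0 e by simp
    finally have "V.lincomb e (set ?bs) \<in> ?Z" using V.lincomb_closed[OF bsV, of e] by simp
    then have "V.lincomb e (set ?bs) = \<zero>\<^bsub>V\<^esub>" unfolding Z by simp
    then have "e \<in> set ?bs \<rightarrow> {\<zero>\<^bsub>class_ring\<^esub>}"
      using bs(2) unfolding V.basis_def by (intro V.not_lindepD[OF _ _ subset_refl]) auto
    then have "e (?bs ! i) = 0" using i by auto
    then show "c i = 0" using e[OF i] by simp
  qed
qed

theorem corollary1p4:
  fixes V :: "('F::field, 'v) module" and p :: "'v \<Rightarrow> 'F"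
    and W :: "('F, 'w) module" and q :: "'w \<Rightarrow> 'F"
    and u :: nat
  assumes char2: "CHAR('F) = 2"
    and p: "quasilinear_form class_ring V p" "anisotropic class_ring V p"
      "vectorspace.dim class_ring V \<ge> 2"
    and q: "quasilinear_form class_ring W q" "anisotropic class_ring W q"
      "vectorspace.dim class_ring W \<ge> 2"
    and u: "u = multiplicity 2 (dim_Izh V p)"
  shows "i1 V p \<le> 2 ^ u \<and>
    (isotropic_over W q V p \<longrightarrow>
       vectorspace.dim class_ring W > dim_Izh V p \<and>
       int (isotropy_index_over W q V p)
         \<le> max (int (vectorspace.dim class_ring W) - int (dim_Izh V p) - 2 ^ u) (2 ^ u))"
proof -
  let ?n = "length (chosen_basis class_ring V)" and ?m = "length (chosen_basis class_ring W)"
  let ?a = "\<lambda>i. p (chosen_basis class_ring V ! i)" and ?b = "\<lambda>i. q (chosen_basis class_ring W ! i)"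
  have n: "?n = vectorspace.dim class_ring V" and m: "?m = vectorspace.dim class_ring W"
    using chosen_basis(3) p(1) q(1) by (auto simp: quasilinear_form_def)
  have "(2 :: 'F) = 0" using of_nat_CHAR[where ?'a = 'F] char2 by simp
  then interpret quadric V p
    using p(3) n anisotropic_square_indep[OF p(1,2)] by (unfold_locales) simp_all
  obtain d where d: "tc.dimension d K1 (const_frac_span K1 ?n ?a)" by (rule const_frac_span_dimension[OF K1])
  obtain t where t: "tc.dimension t K1 (const_frac_span K1 ?m ?b)" by (rule const_frac_span_dimension[OF K1])
  \<comment> \<open>With \<open>p\<close> in both roles, the span \<open>T\<close> has dimension
    \<open>d\<close>; this identifies \<open>d\<close> as the Izhboldin dimension.\<close>
  have i1: "d + i1 V p = ?n" unfolding i1_def by (rule isotropy_index_over_eq[OF d])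
  then have Izh: "dim_Izh V p = d" using n by (simp add: dim_Izh_def)
  have it: "t + isotropy_index_over W q V p = ?m" by (rule isotropy_index_over_eq[OF t])
  \<comment> \<open>Here \<open>t = d\<close>, so the third bound would read
    \<open>d + 2 ^ u \<le> d\<close>.\<close>
  have P: "\<not> ?n > d + 2 ^ u"
    using isotropy_bounds(3)[OF indep d d] u Izh by auto
  have iso: "isotropic_over W q V p \<longleftrightarrow> isotropy_index_over W q V p \<noteq> 0"
    by (simp add: isotropic_over_def isotropy_index_over_def anisotropic_def)
  have Q: "d \<le> t" if "?m > t" using isotropy_bounds(2)[OF anisotropic_square_indep[OF q(1,2)] t d that] .
  have Q': "d + 2 ^ u \<le> t" if "?m > t + 2 ^ u"
    using isotropy_bounds(3)[OF anisotropic_square_indep[OF q(1,2)] t d] that u Izh by simp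
  \<comment> \<open>If the isotropy index \<open>?m - t\<close> exceeds \<open>2 ^ u\<close>, then
    \<open>t \<ge> d + 2 ^ u\<close> bounds it by \<open>?m - d - 2 ^ u\<close>; otherwise the
    second term of the maximum bounds it.\<close>
  have "int (isotropy_index_over W q V p) \<le> max (int ?m - int d - 2 ^ u) (2 ^ u)"
  proof (cases "?m > t + 2 ^ u")
    case True
    then have "int d + 2 ^ u \<le> int t" using Q' by (metis of_nat_add of_nat_le_iff of_nat_numeral of_nat_power)
    then show ?thesis using it by linarith
  next
    case False
    then have "isotropy_index_over W q V p \<le> 2 ^ u" using it by linarith
    then have "int (isotropy_index_over W q V p) \<le> 2 ^ u" by (metis of_nat_le_iff of_nat_numeral of_nat_power)
    then show ?thesis by linarith
  qed
  moreover have "i1 V p \<le> 2 ^ u" using P i1 by linarith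
  \<comment> \<open>Isotropy means \<open>t < ?m\<close>, and then \<open>d \<le> t\<close>.\<close>
  moreover have "?m > d" if "isotropic_over W q V p"
    using that it Q unfolding iso by linarith
  ultimately show ?thesis using m Izh by simp
qed

end
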